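(* Let $\alpha\ge 1/2$ and $\lambda>0$, and let $X_r$ be the output of the quadratic gamma channel with parameters $(\alpha,\lambda)$ and input $X$ (see context). (i) If $X\sim\gamma(\alpha,\lambda)$, then for all $r>0$, $$\frac{d}{dr}I(X;X_r)\le\frac{\alpha}{1+r}\qquad\text{and}\qquad I(X;X_r)\le\alpha\log(1+r).$$ (ii) If $X\sim\gamma(\alpha,\nu)$ with $\nu>0$, then for all $r>0$, $$I(X;X_r)\le\alpha\log\Big(1+\frac{\lambda r}{\nu}\Big).$$
   Context: For $a,b>0$, $\gamma(a,b)$ denotes (a random variable with) the gamma distribution with density $\frac{b^{a}}{\Gamma(a)}x^{a-1}e^{-bx}$ on $(0,\infty)$; $\gamma(0,b)$ is understood as the constant $0$. Quadratic gamma channel: with $X$, $\gamma(\alpha-\tfrac12,\lambda)$ and a standard Gaussian $N$ mutually independent, $$X_r=\gamma(\alpha-\tfrac12,\lambda)+\left(\sqrt{rX}+\frac{N}{\sqrt{2\lambda}}\right)^2,\qquad r>0.$$ Mutual information: $I(X;Y)=E\big[\log\frac{dP^{X,Y}}{d(P^X\otimes P^Y)}(X,Y)\big]$, where $P^{X,Y}$ is the joint law of $(X,Y)$ and $P^X,P^Y$ are its marginals. *)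

theory Defs
  imports "HOL-Probability.Probability"
begin

definition gamma_density :: "real \<Rightarrow> real \<Rightarrow> real \<Rightarrow> real" where
  "gamma_density a b x =
     (if 0 < x then b powr a / Gamma a * x powr (a - 1) * exp (- b * x) else 0)"

definition gamma_law :: "real \<Rightarrow> real \<Rightarrow> real measure" where
  "gamma_law a b =
     (if a = 0 then return borel 0
      else density lborel (\<lambda>x. ennreal (gamma_density a b x)))"

text \<open>The second argument \<open>G\<close> is the additive gamma variable and \<open>N\<close> the Gaussian one.\<close>

definition quadratic_gamma_output ::
  "real \<Rightarrow> ('a \<Rightarrow> real) \<Rightarrow> ('a \<Rightarrow> real) \<Rightarrow> ('a \<Rightarrow> real) \<Rightarrow> real \<Rightarrow> 'a \<Rightarrow> real" where
  "quadratic_gamma_output l G N X r =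
     (\<lambda>\<omega>. G \<omega> + (sqrt (r * X \<omega>) + N \<omega> / sqrt (2 * l))\<^sup>2)"

abbreviation mutual_info :: "'a measure \<Rightarrow> ('a \<Rightarrow> real) \<Rightarrow> ('a \<Rightarrow> real) \<Rightarrow> real" where
  "mutual_info M X Y \<equiv> prob_space.mutual_information M (exp 1) borel borel X Y"

text \<open>
  The library's \<open>mutual_information\<close> is a Bochner integral of a Radon-Nikodym derivative, so it
  takes a default value when the joint law is not absolutely continuous with respect to the
  product of the marginals or when the logarithm of the density is not integrable.  The following
  predicate says that neither happens, i.e. that the mutual information genuinely exists and is
  finite.
\<close>

definition mutual_info_finite :: "'a measure \<Rightarrow> ('a \<Rightarrow> real) \<Rightarrow> ('a \<Rightarrow> real) \<Rightarrow> bool" where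
  "mutual_info_finite M X Y \<longleftrightarrow>
     (let P = distr M borel X \<Otimes>\<^sub>M distr M borel Y;
          J = distr M (borel \<Otimes>\<^sub>M borel) (\<lambda>\<omega>. (X \<omega>, Y \<omega>))
      in absolutely_continuous P J \<and> integrable J (entropy_density (exp 1) P J))"

end

theory Submission
  imports Defs "HOL-Real_Asymp.Real_Asymp"
begin

text \<open>
Given an input \<open>x\<close>, the scaled output \<open>u = l X\<^sub>r\<close> is noncentral gamma: with \<open>b = l r x\<close> its density is
\<open>exp (- b) f(b u)\<close> times the density of \<open>gamma_law a 1\<close> at \<open>u\<close>, where \<open>f = hyp01 a\<close> is the function \<open>0F1(; a; z)\<close>
(lemma \<open>nn_integral_quadratic_gamma_noise\<close>).  The Gaussian square alone gives this for \<open>a = 1/2\<close>, where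
\<open>f(z) = cosh (2 \<surd>z)\<close>, and the convolution with the added gamma variable raises \<open>1/2\<close> to \<open>a\<close>.  For a gamma
input of rate \<open>\<nu>\<close> everything depends on \<open>s = l r / \<nu>\<close> only, and the output is again gamma.  Therefore the
log-likelihood ratio is explicit: with the scaled input \<open>V = \<nu> X\<close> and the scaled output \<open>U\<close> it is
\<open>a ln (1 + s) - s V - s / (1 + s) U + ln f(s V U)\<close>, so that
\<open>I = a ln (1 + s) - 2 s a + E[h(s V)]\<close>, where \<open>h(b)\<close> is the mean of \<open>ln f(b U)\<close> for
the input \<open>V = b / s\<close> (lemma \<open>mutual_info_formula\<close>, with \<open>h = mean_ln_hyp01 a\<close>).

Since \<open>V\<close> has mean \<open>a\<close>, both bounds follow from \<open>h(0) = 0\<close> and \<open>0 \<le> h' \<le> 2\<close>: integrating gives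
\<open>E[h(s V)] \<le> 2 s a\<close>, and differentiating under the expectation gives a derivative of at most \<open>2 a\<close>, so that
the derivative of \<open>I\<close> in \<open>s\<close> is at most \<open>a / (1 + s)\<close>.

Differentiation under the integral and one integration by parts in \<open>u\<close>, based on the differential equation
\<open>z f'' + a f' = f\<close>, show that \<open>h'(b)\<close> equals \<open>1\<close> plus the mean of \<open>z (f'(z) / f(z))\<^sup>2\<close> at \<open>z = b U\<close>
(lemmas \<open>deriv_unnormalised_mean_ln\<close> and \<open>mean_ln_hyp01_parts\<close>).  That quantity is at most \<open>1\<close>, because
\<open>f\<^sup>2 - z f'\<^sup>2\<close> is positive at \<open>0\<close> and has derivative \<open>(2 a - 1) f'\<^sup>2 \<ge> 0\<close> when \<open>a \<ge> 1/2\<close>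
(lemma \<open>hyp01_log_deriv_bound\<close>).
\<close>

section \<open>The confluent hypergeometric limit function\<close>

text \<open>
The hypergeometric function \<open>0F1(; a; z)\<close>: up to a power of \<open>z\<close> the Bessel function
\<open>I\<^bsub>a-1\<^esub>(2 \<surd>z)\<close>, normalised to be \<open>1\<close> at \<open>z = 0\<close>.  It is the part of the channel's transition density that couples input and output.
\<close>
definition hyp01 :: "real \<Rightarrow> real \<Rightarrow> real" where
  "hyp01 a z = (\<Sum>k. inverse (fact k * pochhammer a k) * z ^ k)"

lemma pochhammer_ge_first_factor:
  fixes a :: real
  assumes "a > 0" and "k > 0"
  shows "pochhammer a k \<ge> a"
  using \<open>k > 0\<close>
proof (induction k)
  case (Suc k)
  show ?case
  proof (cases "k = 0")
    case False
    have "a * 1 \<le> pochhammer a k * (a + real k)"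
      using Suc False assms by (intro mult_mono) auto
    then show ?thesis by (simp add: pochhammer_Suc)
  qed simp
qed simp

lemma summable_hyp01:
  fixes a z :: real
  assumes a: "a > 0"
  shows "summable (\<lambda>k. inverse (fact k * pochhammer a k) * z ^ k)"
proof (rule summable_comparison_test')
  show "summable (\<lambda>k. inverse a * (\<bar>z\<bar> ^ k /\<^sub>R fact k))"
    by (intro summable_mult summable_exp_generic)
  fix k :: nat assume k: "k \<ge> 1"
  have p: "pochhammer a k \<ge> a" using pochhammer_ge_first_factor[OF a] k by auto
  have "inverse (pochhammer a k) \<le> inverse a"
    using p a by (intro le_imp_inverse_le) auto
  then have "inverse (pochhammer a k) * (\<bar>z\<bar> ^ k / fact k) \<le> inverse a * (\<bar>z\<bar> ^ k / fact k)"
    by (intro mult_right_mono) auto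
  then show "norm (inverse (fact k * pochhammer a k) * z ^ k) \<le> inverse a * (\<bar>z\<bar> ^ k /\<^sub>R fact k)"
    using p a by (simp add: abs_mult power_abs field_simps)
qed

lemma hyp01_0 [simp]: "hyp01 a 0 = 1"
proof -
  have "hyp01 a 0 = (\<Sum>k\<in>{0}. inverse (fact k * pochhammer a k) * 0 ^ k)"
    unfolding hyp01_def by (rule suminf_finite) auto
  then show ?thesis by simp
qed

lemma hyp01_deriv:
  assumes a: "a > 0"
  shows "(hyp01 a has_real_derivative hyp01 (a + 1) z / a) (at z)"
proof -
  have "((\<lambda>z. \<Sum>k. inverse (fact k * pochhammer a k) * z ^ k) has_real_derivative
          (\<Sum>k. diffs (\<lambda>k. inverse (fact k * pochhammer a k)) k * z ^ k)) (at z)"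
    by (intro termdiffs_strong_converges_everywhere summable_hyp01 a)
  also have "(\<lambda>k. diffs (\<lambda>k. inverse (fact k * pochhammer a k)) k * z ^ k) =
      (\<lambda>k. inverse a * (inverse (fact k * pochhammer (a + 1) k) * z ^ k))"
    by (rule ext) (simp add: diffs_def pochhammer_rec divide_simps)
  also have "(\<Sum>k. inverse a * (inverse (fact k * pochhammer (a + 1) k) * z ^ k)) = hyp01 (a + 1) z / a"
    using a suminf_mult[OF summable_hyp01[of "a + 1" z], of "inverse a"]
    by (simp add: hyp01_def divide_inverse mult.commute)
  finally show ?thesis by (simp add: hyp01_def[abs_def])
qed

lemmas hyp01_deriv_chain [derivative_intros] = hyp01_deriv[THEN DERIV_chain2]

lemma hyp01_cont: "a > 0 \<Longrightarrow> isCont (hyp01 a) z"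
  using hyp01_deriv DERIV_isCont by blast

lemma hyp01_continuous_on: "a > 0 \<Longrightarrow> continuous_on A (hyp01 a)"
  by (intro continuous_at_imp_continuous_on ballI hyp01_cont)

lemma hyp01_measurable [measurable]:
  "hyp01 a \<in> borel_measurable borel"
proof -
  have "(\<lambda>z. \<Sum>k. inverse (fact k * pochhammer a k) * z ^ k) \<in> borel_measurable borel"
    by measurable
  then show ?thesis by (simp add: hyp01_def[abs_def])
qed

lemma hyp01_ge_1:
  assumes a: "a > 0" and z: "z \<ge> 0"
  shows "hyp01 a z \<ge> 1"
proof -
  have "(\<Sum>k\<in>{0}. inverse (fact k * pochhammer a k) * z ^ k) \<le> hyp01 a z"
    unfolding hyp01_def using a z
    by (intro sum_le_suminf summable_hyp01)
       (auto intro!: mult_nonneg_nonneg less_imp_le[OF pochhammer_pos])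
  then show ?thesis by simp
qed

lemma hyp01_pos: "a > 0 \<Longrightarrow> z \<ge> 0 \<Longrightarrow> hyp01 a z > 0"
  using hyp01_ge_1[of a z] by linarith

lemma hyp01_mono:
  assumes a: "a > 0" and "0 \<le> x" "x \<le> y"
  shows "hyp01 a x \<le> hyp01 a y"
proof (rule DERIV_nonneg_imp_nondecreasing[OF \<open>x \<le> y\<close>, of "hyp01 a"])
  fix z assume "x \<le> z" "z \<le> y"
  then show "\<exists>d. (hyp01 a has_real_derivative d) (at z) \<and> d \<ge> 0"
    using assms hyp01_pos[of "a + 1" z] by (intro exI[of _ "hyp01 (a + 1) z / a"] conjI hyp01_deriv) auto
qed

lemma hyp01_antimono_param:
  assumes a: "0 < a" and ab: "a \<le> b" and z: "0 \<le> z"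
  shows "hyp01 b z \<le> hyp01 a z"
  unfolding hyp01_def
proof (intro suminf_le summable_hyp01)
  fix k
  have "pochhammer a k \<le> pochhammer b k"
    unfolding pochhammer_prod using a ab by (intro prod_mono) auto
  moreover have "pochhammer a k > 0" using a by (rule pochhammer_pos)
  ultimately show "inverse (fact k * pochhammer b k) * z ^ k \<le> inverse (fact k * pochhammer a k) * z ^ k"
    using z by (intro mult_right_mono le_imp_inverse_le) auto
qed (use a ab in auto)

text \<open>
Together with \<open>hyp01_deriv\<close> this says that \<open>f = hyp01 a\<close> solves \<open>z f'' + a f' = f\<close>; all
differential identities below use it in this form, which avoids second derivatives.
\<close>
lemma hyp01_contiguous:
  assumes a: "a > 0"
  shows "hyp01 a z = hyp01 (a + 1) z + z / (a * (a + 1)) * hyp01 (a + 2) z"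
proof -
  let ?c = "\<lambda>a k. inverse (fact k * pochhammer a k) * z ^ k"
  have S: "summable (?c a)" if "a > 0" for a using summable_hyp01[OF that] .
  have "hyp01 a z = 1 + (\<Sum>k. ?c a (Suc k))"
    using suminf_split_head[OF S[OF a]] by (simp add: hyp01_def)
  also have "(\<lambda>k. ?c a (Suc k)) = (\<lambda>k. ?c (a + 1) (Suc k) + z / (a * (a + 1)) * ?c (a + 2) k)"
  proof
    fix k
    let ?p = "pochhammer (a + 2) k"
    have p: "?p > 0" using a by (intro pochhammer_pos) auto
    have 1: "pochhammer (a + 1) (Suc k) = (a + 1) * ?p"
      using pochhammer_rec[of "a + 1" k] by (simp add: add.assoc)
    have 2: "pochhammer (a + 1) k * (a + 1 + k) = (a + 1) * ?p"
      using 1 by (simp add: pochhammer_Suc)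
    have "pochhammer a (Suc k) * (a + 1 + k) = a * ((a + 1) * ?p)"
      unfolding pochhammer_rec[of a] using 2 by (simp add: mult.assoc)
    then have 3: "pochhammer a (Suc k) = a * ((a + 1) * ?p) / (a + 1 + k)"
      using a by (simp add: field_simps)
    show "?c a (Suc k) = ?c (a + 1) (Suc k) + z / (a * (a + 1)) * ?c (a + 2) k"
      unfolding 1 3 using a p by (simp add: divide_simps) (simp add: algebra_simps)
  qed
  also have "(\<Sum>k. ?c (a + 1) (Suc k) + z / (a * (a + 1)) * ?c (a + 2) k) =
      (\<Sum>k. ?c (a + 1) (Suc k)) + z / (a * (a + 1)) * (\<Sum>k. ?c (a + 2) k)"
  proof -
    have "summable (\<lambda>k. ?c (a + 1) (Suc k))"
      using S[of "a + 1"] a by (subst summable_Suc_iff) auto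
    moreover have s2: "summable (?c (a + 2))" using S[of "a + 2"] a by auto
    ultimately show ?thesis
      using suminf_mult[OF s2, of "z / (a * (a + 1))"]
        suminf_add[of "\<lambda>k. ?c (a + 1) (Suc k)" "\<lambda>k. z / (a * (a + 1)) * ?c (a + 2) k"]
        summable_mult[OF s2, of "z / (a * (a + 1))"] by simp
  qed
  also have "1 + \<dots> = hyp01 (a + 1) z + z / (a * (a + 1)) * hyp01 (a + 2) z"
    using suminf_split_head[OF S[of "a + 1"]] a by (simp add: hyp01_def)
  finally show ?thesis .
qed

text \<open>
The even part of \<open>exp (2 \<surd>z)\<close>: this is how the two preimages \<open>\<plusminus>t\<close> of a square
lead to \<open>hyp01\<close>.
\<close>
lemma hyp01_half:
  assumes z: "z \<ge> 0"
  shows "hyp01 (1/2) z = cosh (2 * sqrt z)"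
proof -
  let ?f = "\<lambda>n. if even n then (2 * sqrt z) ^ n /\<^sub>R fact n else 0"
  have "?f sums cosh (2 * sqrt z)" by (rule cosh_converges)
  then have "(\<lambda>k. ?f (2 * k)) sums cosh (2 * sqrt z)"
    by (subst sums_mono_reindex[where g = "\<lambda>k. 2 * k" and f = ?f])
       (auto simp: strict_mono_def elim!: oddE evenE)
  also have "(\<lambda>k. ?f (2 * k)) = (\<lambda>k. inverse (fact k * pochhammer (1/2) k) * z ^ k)"
  proof
    fix k
    have "(fact (2 * k) :: real) = 4 ^ k * pochhammer (1/2) k * fact k"
      using pochhammer_double[of "1/2::real" k] by (simp add: pochhammer_fact power_mult)
    moreover have "(2 * sqrt z) ^ (2 * k) = 4 ^ k * z ^ k"
      using z by (simp add: power_mult power_mult_distrib)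
    ultimately show "?f (2 * k) = inverse (fact k * pochhammer (1/2) k) * z ^ k"
      by (simp add: divide_simps)
  qed
  finally show ?thesis by (simp add: hyp01_def sums_iff)
qed

text \<open>
The inequality behind the theorem: with \<open>f = hyp01 a\<close> it reads \<open>z f'\<^sup>2 \<le> f\<^sup>2\<close>.  The differential
equation gives \<open>(f\<^sup>2 - z f'\<^sup>2)' = (2 a - 1) f'\<^sup>2\<close>, which is where \<open>a \<ge> 1/2\<close> enters; for
\<open>a = 1/2\<close> the inequality is \<open>tanh\<^sup>2 \<le> 1\<close>.
\<close>
lemma hyp01_log_deriv_bound:
  assumes a: "a \<ge> 1/2" and z: "z \<ge> 0"
  shows "z * (hyp01 (a + 1) z / a)\<^sup>2 \<le> (hyp01 a z)\<^sup>2"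
proof -
  let ?E = "\<lambda>z. (hyp01 a z)\<^sup>2 - z * (hyp01 (a + 1) z / a)\<^sup>2"
  have "?E 0 \<le> ?E z"
  proof (rule DERIV_nonneg_imp_nondecreasing[OF z])
    fix x :: real assume x: "0 \<le> x" "x \<le> z"
    let ?p = "hyp01 (a + 1) x" and ?q = "hyp01 (a + 2) x"
    let ?D = "2 * hyp01 a x * (?p / a) - ((?p / a)\<^sup>2 + x * (2 * (?p / a) * (?q / (a + 1) / a)))"
    have 1: "a + 1 + 1 = a + 2" by simp
    have a0: "a > 0" using a by simp
    have nz: "a \<noteq> 0" "a + 1 \<noteq> 0" using a by auto
    have "(?E has_real_derivative ?D) (at x)"
      using a by (auto intro!: derivative_eq_intros hyp01_deriv[of "a + 1", unfolded 1]
          simp: power2_eq_square 1) (use nz in \<open>simp add: divide_simps\<close>)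
    moreover have "?D = (2 * a - 1) * (?p / a)\<^sup>2"
      unfolding hyp01_contiguous[of a x, OF a0] using nz
      by (simp add: divide_simps power2_eq_square) (simp add: algebra_simps)
    ultimately show "\<exists>D. (?E has_real_derivative D) (at x) \<and> 0 \<le> D"
      using a by auto
  qed
  then show ?thesis by simp
qed

section \<open>Gamma densities and their Poisson mixtures\<close>

lemma gamma_density_measurable [measurable]: "gamma_density a b \<in> borel_measurable borel"
  unfolding gamma_density_def[abs_def] by measurable

lemma gamma_density_nonneg: "a > 0 \<Longrightarrow> gamma_density a b x \<ge> 0"
  by (simp add: gamma_density_def Gamma_real_pos less_imp_le)

lemma gamma_density_nonpos_arg [simp]: "x \<le> 0 \<Longrightarrow> gamma_density a b x = 0"
  by (simp add: gamma_density_def)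

lemma nn_integral_gamma_density_scale:
  assumes a: "a > 0" and b: "b > 0" and [measurable]: "f \<in> borel_measurable borel"
  shows "(\<integral>\<^sup>+x. ennreal (gamma_density a b x) * f x \<partial>lborel) =
         (\<integral>\<^sup>+v. ennreal (gamma_density a 1 v) * f (v / b) \<partial>lborel)"
proof -
  have *: "gamma_density a 1 (b * x) * b = gamma_density a b x" for x
    using b by (auto simp: gamma_density_def zero_less_mult_iff powr_mult powr_diff divide_simps)
  have "(\<integral>\<^sup>+v. ennreal (gamma_density a 1 v) * f (v / b) \<partial>lborel) =
     ennreal b * (\<integral>\<^sup>+x. ennreal (gamma_density a 1 (b * x)) * f x \<partial>lborel)"
    using b by (subst nn_integral_real_affine[of _ b 0]) auto
  also have "\<dots> = (\<integral>\<^sup>+x. ennreal (gamma_density a b x) * f x \<partial>lborel)"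
    by (subst nn_integral_cmult[symmetric])
       (auto simp: *[symmetric] ennreal_mult gamma_density_nonneg[OF a] less_imp_le[OF b] ac_simps
          intro!: nn_integral_cong)
  finally show ?thesis ..
qed

lemma nn_integral_gamma_density_1:
  assumes a: "a > 0"
  shows "(\<integral>\<^sup>+v. ennreal (gamma_density a 1 v) \<partial>lborel) = 1"
proof -
  have G: "Gamma a > 0" using a by (rule Gamma_real_pos)
  have "(\<integral>\<^sup>+v. ennreal (gamma_density a 1 v) \<partial>lborel) =
      (\<integral>\<^sup>+t. ennreal (1 / Gamma a) * ennreal (indicator {0..} t * t powr (a - 1) / exp t) \<partial>lborel)"
    using G by (intro nn_integral_cong)
       (auto simp: gamma_density_def ennreal_mult[symmetric] exp_minus field_simps indicator_def)
  also have "\<dots> = ennreal (1 / Gamma a) * ennreal (Gamma a)"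
    using Gamma_conv_nn_integral_real[OF a] by (subst nn_integral_cmult) auto
  also have "\<dots> = 1"
    using G by (simp add: ennreal_mult[symmetric])
  finally show ?thesis .
qed

lemma pos_real_not_nonpos_Int: "a > 0 \<Longrightarrow> a \<notin> \<int>\<^sub>\<le>\<^sub>0" for a :: real
  by (auto elim!: nonpos_Ints_cases)

lemma times_gamma_density:
  assumes "a > 0"
  shows "u * gamma_density a 1 u = a * gamma_density (a + 1) 1 u"
  using assms Gamma_real_pos[of a] Gamma_plus1[OF pos_real_not_nonpos_Int[OF assms]]
  by (auto simp: gamma_density_def powr_diff divide_simps)

lemma power_times_gamma_density:
  assumes "a > 0"
  shows "u ^ k * gamma_density a 1 u = pochhammer a k * gamma_density (a + real k) 1 u"
proof (induction k)
  case (Suc k)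
  have "u ^ Suc k * gamma_density a 1 u = u * (pochhammer a k * gamma_density (a + real k) 1 u)"
    using Suc by simp
  also have "\<dots> = pochhammer a k * ((a + real k) * gamma_density (a + real k + 1) 1 u)"
    using times_gamma_density[of "a + real k" u] assms by (simp add: mult.left_commute)
  finally show ?case by (simp add: pochhammer_Suc algebra_simps)
qed simp

text \<open>
Up to the factor \<open>exp (- b)\<close>, the noncentral gamma density is the mixture of the densities
\<open>gamma_density (a + k) 1\<close> with Poisson weights in \<open>k\<close>.  Integrals and convolutions of
it therefore reduce termwise to those of gamma densities.
\<close>
lemma gamma_density_hyp01_mixture:
  assumes a: "a > 0" and b: "b \<ge> 0"
  shows "ennreal (gamma_density a 1 u * hyp01 a (b * u)) =
         (\<Sum>k. ennreal (b ^ k / fact k) * ennreal (gamma_density (a + real k) 1 u))"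
proof -
  let ?t = "\<lambda>k. inverse (fact k * pochhammer a k) * (b * u) ^ k"
  have "gamma_density a 1 u * hyp01 a (b * u) = (\<Sum>k. gamma_density a 1 u * ?t k)"
    unfolding hyp01_def using summable_hyp01[OF a] by (intro suminf_mult[symmetric])
  also have fn: "(\<lambda>k. gamma_density a 1 u * ?t k) = (\<lambda>k. b ^ k / fact k * gamma_density (a + real k) 1 u)"
  proof
    fix k
    have "pochhammer a k > 0" using a by (rule pochhammer_pos)
    then show "gamma_density a 1 u * ?t k = b ^ k / fact k * gamma_density (a + real k) 1 u"
      using power_times_gamma_density[OF a, of u k] by (simp add: field_simps power_mult_distrib)
  qed
  finally have eq: "gamma_density a 1 u * hyp01 a (b * u) =
      (\<Sum>k. b ^ k / fact k * gamma_density (a + real k) 1 u)" .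
  have "summable (\<lambda>k. gamma_density a 1 u * ?t k)"
    using summable_hyp01[OF a] by (intro summable_mult)
  then have "ennreal (gamma_density a 1 u * hyp01 a (b * u)) =
      (\<Sum>k. ennreal (b ^ k / fact k * gamma_density (a + real k) 1 u))"
    unfolding eq fn using a b
    by (intro suminf_ennreal2[symmetric] mult_nonneg_nonneg gamma_density_nonneg) auto
  then show ?thesis
    using a b by (subst ennreal_mult[symmetric]) (auto simp: gamma_density_nonneg)
qed

lemma gamma_density_hyp01_nonneg:
  assumes "a > 0" "b \<ge> 0"
  shows "gamma_density a 1 u * hyp01 a (b * u) \<ge> 0"
proof (cases "u > 0")
  case True
  then show ?thesis
    using gamma_density_nonneg[OF assms(1), of 1 u] hyp01_pos[of a "b * u"] assms by auto
qed simp

lemma nn_integral_gamma_density_hyp01: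
  assumes a: "a > 0" and b: "b \<ge> 0"
  shows "(\<integral>\<^sup>+u. ennreal (gamma_density a 1 u * hyp01 a (b * u)) \<partial>lborel) = ennreal (exp b)"
proof -
  have "(\<integral>\<^sup>+u. ennreal (gamma_density a 1 u * hyp01 a (b * u)) \<partial>lborel) =
      (\<Sum>k. \<integral>\<^sup>+u. ennreal (b ^ k / fact k) * ennreal (gamma_density (a + real k) 1 u) \<partial>lborel)"
    using a b unfolding gamma_density_hyp01_mixture[OF a b]
    by (subst nn_integral_suminf) auto
  also have "\<dots> = (\<Sum>k. ennreal (b ^ k /\<^sub>R fact k))"
    using a by (subst nn_integral_cmult) (auto simp: nn_integral_gamma_density_1 divide_inverse mult.commute)
  also have "\<dots> = ennreal (exp b)"
    using b exp_converges[of b] by (subst suminf_ennreal2) (auto simp: sums_iff exp_def)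
  finally show ?thesis .
qed

text \<open>
After rescaling to \<open>u = w t\<close> this is Euler's Beta integral.
\<close>
lemma gamma_density_convolution:
  assumes p: "p > 0" and q: "q > 0"
  shows "(\<integral>\<^sup>+u. ennreal (gamma_density p 1 (w - u)) * ennreal (gamma_density q 1 u) \<partial>lborel) =
         ennreal (gamma_density (p + q) 1 w)"
proof (cases "w > 0")
  case False
  then have "gamma_density p 1 (w - u) = 0 \<or> gamma_density q 1 u = 0" for u
    by (cases "u > 0") auto
  then have "ennreal (gamma_density p 1 (w - u)) * ennreal (gamma_density q 1 u) = 0" for u
    by (metis ennreal_0 mult_zero_left mult_zero_right)
  then show ?thesis using False by (simp del: mult_eq_0_iff)
next
  case True
  have G: "Gamma p > 0" "Gamma q > 0" "Gamma (p + q) > 0" using p q by (auto intro!: Gamma_real_pos)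
  let ?C = "w powr (p + q - 2) * exp (- w) / (Gamma p * Gamma q)"
  have "(\<integral>\<^sup>+u. ennreal (gamma_density p 1 (w - u)) * ennreal (gamma_density q 1 u) \<partial>lborel) =
      ennreal w * (\<integral>\<^sup>+t. ennreal (gamma_density p 1 (w - w * t)) * ennreal (gamma_density q 1 (w * t)) \<partial>lborel)"
    using True by (subst nn_integral_real_affine[of _ w 0]) auto
  also have "(\<integral>\<^sup>+t. ennreal (gamma_density p 1 (w - w * t)) * ennreal (gamma_density q 1 (w * t)) \<partial>lborel)
    = (\<integral>\<^sup>+t. ennreal ?C * ennreal (indicator {0..1} t * (t powr (q - 1) * (1 - t) powr (p - 1))) \<partial>lborel)"
  proof (intro nn_integral_cong)
    fix t :: real
    show "ennreal (gamma_density p 1 (w - w * t)) * ennreal (gamma_density q 1 (w * t)) =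
       ennreal ?C * ennreal (indicator {0..1} t * (t powr (q - 1) * (1 - t) powr (p - 1)))"
    proof (cases "0 < t \<and> t < 1")
      case t: True
      have e: "w - w * t = w * (1 - t)" by (simp add: algebra_simps)
      have pw: "w powr (p + q - 2) = w powr (p - 1) * w powr (q - 1)"
        by (simp add: powr_add[symmetric] algebra_simps)
      have ex: "exp (- w) = exp (- (w * (1 - t))) * exp (- (w * t))"
        by (simp add: mult_exp_exp algebra_simps)
      have "gamma_density p 1 (w - w * t) * gamma_density q 1 (w * t) =
          ?C * (indicator {0..1} t * (t powr (q - 1) * (1 - t) powr (p - 1)))"
        unfolding e pw ex using t True by (simp add: gamma_density_def powr_mult)
      then show ?thesis
        using G p q t True by (subst (1 2) ennreal_mult[symmetric]) (auto simp: gamma_density_nonneg)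
    next
      case False
      then have "w * t \<le> 0 \<or> w - w * t \<le> 0"
        using True by (auto simp: mult_le_0_iff not_less)
      moreover have "indicator {0..1} t * (t powr (q - 1) * (1 - t) powr (p - 1)) = (0::real)"
        using False by (auto simp: indicator_def not_less)
      ultimately show ?thesis by auto
    qed
  qed
  also have "\<dots> = ennreal ?C * ennreal (Beta q p)"
    using nn_integral_has_integral_lebesgue[OF _ has_integral_Beta_real[OF q p]]
    by (subst nn_integral_cmult) auto
  also have "ennreal w * (ennreal ?C * ennreal (Beta q p)) = ennreal (w * (?C * Beta q p))"
  proof -
    have 1: "?C \<ge> 0" and 2: "Beta q p \<ge> 0" using G by (auto simp: Beta_def add.commute)
    show ?thesis
      using ennreal_mult[OF _ mult_nonneg_nonneg[OF 1 2], of w] ennreal_mult[OF 1 2] True by simp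
  qed
  also have "w * (?C * Beta q p) = gamma_density (p + q) 1 w"
    using True G by (simp add: gamma_density_def Beta_def powr_diff divide_simps add.commute power2_eq_square)
  finally show ?thesis .
qed

lemma gamma_density_convolution_hyp01:
  assumes p: "p > 0" and q: "q > 0" and b: "b \<ge> 0"
  shows "(\<integral>\<^sup>+u. ennreal (gamma_density p 1 (w - u)) * ennreal (gamma_density q 1 u * hyp01 q (b * u)) \<partial>lborel) =
         ennreal (gamma_density (p + q) 1 w * hyp01 (p + q) (b * w))"
proof -
  let ?c = "\<lambda>k::nat. b ^ k / fact k"
  have c: "?c k \<ge> 0" for k using b by simp
  have "(\<integral>\<^sup>+u. ennreal (gamma_density p 1 (w - u)) * ennreal (gamma_density q 1 u * hyp01 q (b * u)) \<partial>lborel) =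
    (\<integral>\<^sup>+u. (\<Sum>k. ennreal (?c k) * (ennreal (gamma_density p 1 (w - u)) * ennreal (gamma_density (q + k) 1 u))) \<partial>lborel)"
    using q c by (subst gamma_density_hyp01_mixture[OF q b], subst ennreal_suminf_cmult[symmetric])
      (auto simp: ac_simps)
  also have "\<dots> = (\<Sum>k. ennreal (?c k) * ennreal (gamma_density (p + (q + k)) 1 w))"
    using p q by (subst nn_integral_suminf) (auto simp: nn_integral_cmult gamma_density_convolution)
  also have "\<dots> = ennreal (gamma_density (p + q) 1 w * hyp01 (p + q) (b * w))"
    using p q b c by (subst gamma_density_hyp01_mixture) (auto simp: ac_simps)
  finally show ?thesis .
qed

lemma nn_integral_gamma_plus_hyp01:
  assumes p: "p > 0" and q: "q > 0" and b: "b \<ge> 0" and [measurable]: "f \<in> borel_measurable borel"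
  shows "(\<integral>\<^sup>+g. ennreal (gamma_density p 1 g) *
            (\<integral>\<^sup>+u. ennreal (gamma_density q 1 u * hyp01 q (b * u)) * f (g + u) \<partial>lborel) \<partial>lborel) =
         (\<integral>\<^sup>+w. ennreal (gamma_density (p + q) 1 w * hyp01 (p + q) (b * w)) * f w \<partial>lborel)"
proof -
  let ?k = "\<lambda>u. ennreal (gamma_density q 1 u * hyp01 q (b * u))"
  have "(\<integral>\<^sup>+g. ennreal (gamma_density p 1 g) * (\<integral>\<^sup>+u. ?k u * f (g + u) \<partial>lborel) \<partial>lborel) =
      (\<integral>\<^sup>+g. (\<integral>\<^sup>+u. ennreal (gamma_density p 1 g) * ?k u * f (g + u) \<partial>lborel) \<partial>lborel)"
    by (subst nn_integral_cmult[symmetric]) (auto simp: mult.assoc)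
  also have "\<dots> = (\<integral>\<^sup>+u. (\<integral>\<^sup>+g. ennreal (gamma_density p 1 g) * ?k u * f (g + u) \<partial>lborel) \<partial>lborel)"
    by (rule lborel_pair.Fubini') measurable
  also have "\<dots> = (\<integral>\<^sup>+u. (\<integral>\<^sup>+w. ennreal (gamma_density p 1 (w - u)) * ?k u * f w \<partial>lborel) \<partial>lborel)"
  proof (rule nn_integral_cong)
    fix u :: real
    show "(\<integral>\<^sup>+g. ennreal (gamma_density p 1 g) * ?k u * f (g + u) \<partial>lborel) =
        (\<integral>\<^sup>+w. ennreal (gamma_density p 1 (w - u)) * ?k u * f w \<partial>lborel)"
      by (subst nn_integral_real_affine[of _ 1 "-u"]) (auto simp: add.commute)
  qed
  also have "\<dots> = (\<integral>\<^sup>+w. (\<integral>\<^sup>+u. ennreal (gamma_density p 1 (w - u)) * ?k u * f w \<partial>lborel) \<partial>lborel)"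
    by (rule lborel_pair.Fubini') measurable
  also have "\<dots> = (\<integral>\<^sup>+w. (\<integral>\<^sup>+u. ennreal (gamma_density p 1 (w - u)) * ?k u \<partial>lborel) * f w \<partial>lborel)"
    by (subst nn_integral_multc[symmetric]) auto
  finally show ?thesis
    unfolding gamma_density_convolution_hyp01[OF p q b] .
qed

section \<open>The law of the channel\<close>

text \<open>
The substitution \<open>u = t\<^sup>2\<close> on the compact intervals \<open>{0..n}\<close>, followed by monotone convergence.
\<close>
lemma nn_integral_square_substitution:
  fixes f :: "real \<Rightarrow> ennreal"
  assumes [measurable]: "f \<in> borel_measurable borel"
  shows "(\<integral>\<^sup>+u. f u * indicator {0..} u \<partial>lborel) =
         (\<integral>\<^sup>+t. f (t\<^sup>2) * ennreal (2 * t) * indicator {0..} t \<partial>lborel)"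
proof -
  have eq: "(\<integral>\<^sup>+u. f u * indicator {0..(real n)\<^sup>2} u \<partial>lborel) =
        (\<integral>\<^sup>+t. f (t\<^sup>2) * ennreal (2 * t) * indicator {0..real n} t \<partial>lborel)" for n
  proof (cases "n = 0")
    case True
    then show ?thesis by (simp add: nn_integral_indicator_singleton)
  next
    case False
    have "(\<integral>\<^sup>+u. f u * indicator {0\<^sup>2..(real n)\<^sup>2} u \<partial>lborel) =
        (\<integral>\<^sup>+t. f (t\<^sup>2) * ennreal (2 * t) * indicator {0..real n} t \<partial>lborel)"
      using False by (intro nn_integral_substitution_aux[where g = "\<lambda>t. t\<^sup>2" and g' = "\<lambda>t. 2 * t"])
        (auto intro!: derivative_eq_intros continuous_intros)
    then show ?thesis by simp
  qed
  have "(\<lambda>n. \<integral>\<^sup>+u. f u * indicator {0..(real n)\<^sup>2} u \<partial>lborel) \<longlonglongrightarrow>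
        (\<integral>\<^sup>+u. f u * indicator {0..} u \<partial>lborel)"
  proof (rule nn_integral_LIMSEQ)
    show "incseq (\<lambda>n u. f u * indicator {0..(real n)\<^sup>2} u)"
    proof -
      have mono: "(real m)\<^sup>2 \<le> (real n)\<^sup>2" if "m \<le> n" for m n using that by (intro power_mono) auto
      show ?thesis
        by (auto simp: incseq_def le_fun_def indicator_def) (meson mono order_trans)
    qed
    show "(\<lambda>n. f u * indicator {0..(real n)\<^sup>2} u) \<longlonglongrightarrow> f u * indicator {0..} u" for u
    proof (rule tendsto_eventually)
      obtain m :: nat where m: "sqrt \<bar>u\<bar> \<le> real m" using real_arch_simple by blast
      have "u \<le> (real n)\<^sup>2" if "n \<ge> m" for n
      proof -
        have "(sqrt \<bar>u\<bar>)\<^sup>2 \<le> (real n)\<^sup>2" using m that by (intro power_mono) auto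
        then show ?thesis by simp
      qed
      then show "\<forall>\<^sub>F n in sequentially. f u * indicator {0..(real n)\<^sup>2} u = f u * indicator {0..} u"
        by (intro eventually_sequentiallyI[of m]) (auto simp: indicator_def)
    qed
  qed measurable
  moreover have "(\<lambda>n. \<integral>\<^sup>+t. f (t\<^sup>2) * ennreal (2 * t) * indicator {0..real n} t \<partial>lborel) \<longlonglongrightarrow>
        (\<integral>\<^sup>+t. f (t\<^sup>2) * ennreal (2 * t) * indicator {0..} t \<partial>lborel)"
  proof (rule nn_integral_LIMSEQ)
    show "incseq (\<lambda>n t. f (t\<^sup>2) * ennreal (2 * t) * indicator {0..real n} t)"
      by (auto simp: incseq_def le_fun_def indicator_def)
    show "(\<lambda>n. f (t\<^sup>2) * ennreal (2 * t) * indicator {0..real n} t) \<longlonglongrightarrow>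
        f (t\<^sup>2) * ennreal (2 * t) * indicator {0..} t" for t
    proof (rule tendsto_eventually)
      obtain m :: nat where m: "t \<le> real m" using real_arch_simple by blast
      show "\<forall>\<^sub>F n in sequentially. f (t\<^sup>2) * ennreal (2 * t) * indicator {0..real n} t =
          f (t\<^sup>2) * ennreal (2 * t) * indicator {0..} t"
        using m by (intro eventually_sequentiallyI[of m]) (auto simp: indicator_def)
    qed
  qed measurable
  ultimately show ?thesis
    unfolding eq by (rule LIMSEQ_unique)
qed

lemma nn_integral_lborel_fold:
  fixes f :: "real \<Rightarrow> ennreal"
  assumes [measurable]: "f \<in> borel_measurable borel"
  shows "(\<integral>\<^sup>+t. f t \<partial>lborel) = (\<integral>\<^sup>+t. (f t + f (- t)) * indicator {0..} t \<partial>lborel)"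
proof -
  have "(\<integral>\<^sup>+t. f t \<partial>lborel) = (\<integral>\<^sup>+t. f t * indicator {0..} t + f t * indicator {..0} t \<partial>lborel)"
    using AE_lborel_singleton[of 0]
    by (intro nn_integral_cong_AE) (auto simp: indicator_def elim!: eventually_mono)
  also have "\<dots> = (\<integral>\<^sup>+t. f t * indicator {0..} t \<partial>lborel) + (\<integral>\<^sup>+t. f t * indicator {..0} t \<partial>lborel)"
    by (intro nn_integral_add) measurable
  also have "(\<integral>\<^sup>+t. f t * indicator {..0} t \<partial>lborel) = (\<integral>\<^sup>+t. f (- t) * indicator {0..} t \<partial>lborel)"
    by (subst nn_integral_real_affine[of _ "-1" 0]) (auto intro!: nn_integral_cong simp: indicator_def)
  finally show ?thesis
    by (subst (asm) nn_integral_add[symmetric]) (auto simp: distrib_right)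
qed

text \<open>
A noncentral chi-square law: folding the Gaussian density centred at \<open>\<surd>b\<close> over \<open>\<plusminus>t\<close> produces
\<open>2 exp (- t\<^sup>2 - b) cosh (2 t \<surd>b)\<close>, and the hyperbolic cosine is \<open>hyp01 (1/2) (b t\<^sup>2)\<close>.
\<close>
lemma nn_integral_noncentral_gaussian_square:
  fixes f :: "real \<Rightarrow> ennreal"
  assumes b: "b \<ge> 0" and [measurable]: "f \<in> borel_measurable borel"
  shows "(\<integral>\<^sup>+n. ennreal (std_normal_density n) * f ((sqrt b + n / sqrt 2)\<^sup>2) \<partial>lborel) =
         (\<integral>\<^sup>+u. ennreal (exp (- b)) * ennreal (gamma_density (1/2) 1 u * hyp01 (1/2) (b * u)) * f u \<partial>lborel)"
proof -
  define E where "E t = exp (- (t - sqrt b)\<^sup>2) / sqrt pi" for t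
  have [measurable]: "E \<in> borel_measurable borel" unfolding E_def[abs_def] by measurable
  have E0: "E t \<ge> 0" for t by (simp add: E_def)
  let ?K = "\<lambda>u. exp (- b) * (gamma_density (1/2) 1 u * hyp01 (1/2) (b * u))"
  have K0: "?K u \<ge> 0" for u
    using gamma_density_hyp01_nonneg[of "1/2" b u] b by simp
  have dens: "std_normal_density (- (sqrt 2 * sqrt b) + sqrt 2 * t) * sqrt 2 = E t" for t
  proof -
    have "(- (sqrt 2 * sqrt b) + sqrt 2 * t)\<^sup>2 = 2 * (t - sqrt b)\<^sup>2"
    proof -
      have "- (sqrt 2 * sqrt b) + sqrt 2 * t = sqrt 2 * (t - sqrt b)" by (simp add: algebra_simps)
      then show ?thesis by (simp only: power_mult_distrib) simp
    qed
    then show ?thesis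
      by (simp add: std_normal_density_def E_def real_sqrt_mult)
  qed
  have fold: "E t + E (- t) = ?K (t\<^sup>2) * (2 * t)" if t: "t > 0" for t
  proof -
    have e: "- (t - sqrt b)\<^sup>2 = (- t\<^sup>2 - b) + 2 * (sqrt b * t)"
            "- (- t - sqrt b)\<^sup>2 = (- t\<^sup>2 - b) + - (2 * (sqrt b * t))"
      using b by (auto simp: power2_eq_square algebra_simps)
    have "E t + E (- t) = exp (- t\<^sup>2 - b) * (2 * cosh (2 * (sqrt b * t))) / sqrt pi"
      unfolding E_def e exp_add cosh_def by (simp add: algebra_simps add_divide_distrib)
    moreover have "(t\<^sup>2) powr (-1/2) * t = 1"
      using t by (simp add: powr_minus powr_half_sqrt divide_simps)
    moreover have "hyp01 (1/2) (b * t\<^sup>2) = cosh (2 * (sqrt b * t))"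
      using b t by (subst hyp01_half) (auto simp: real_sqrt_mult)
    moreover have "exp (- t\<^sup>2 - b) = exp (- t\<^sup>2) * exp (- b)" by (simp add: exp_diff exp_minus field_simps)
    ultimately show ?thesis
      using t by (simp add: gamma_density_def Gamma_one_half_real field_simps)
  qed
  have "(\<integral>\<^sup>+n. ennreal (std_normal_density n) * f ((sqrt b + n / sqrt 2)\<^sup>2) \<partial>lborel) =
      ennreal (sqrt 2) * (\<integral>\<^sup>+t. ennreal (std_normal_density (- (sqrt 2 * sqrt b) + sqrt 2 * t)) *
         f ((sqrt b + (- (sqrt 2 * sqrt b) + sqrt 2 * t) / sqrt 2)\<^sup>2) \<partial>lborel)"
    by (subst nn_integral_real_affine[of _ "sqrt 2" "- (sqrt 2 * sqrt b)"]) auto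
  also have "\<dots> = (\<integral>\<^sup>+t. ennreal (sqrt 2) * (ennreal (std_normal_density (- (sqrt 2 * sqrt b) + sqrt 2 * t)) *
         f ((sqrt b + (- (sqrt 2 * sqrt b) + sqrt 2 * t) / sqrt 2)\<^sup>2)) \<partial>lborel)"
    by (rule nn_integral_cmult[symmetric]) measurable
  also have "\<dots> = (\<integral>\<^sup>+t. ennreal (E t) * f (t\<^sup>2) \<partial>lborel)"
  proof (rule nn_integral_cong)
    fix t :: real
    have "sqrt b + (- (sqrt 2 * sqrt b) + sqrt 2 * t) / sqrt 2 = t"
      by (simp add: field_simps)
    then show "ennreal (sqrt 2) * (ennreal (std_normal_density (- (sqrt 2 * sqrt b) + sqrt 2 * t)) *
         f ((sqrt b + (- (sqrt 2 * sqrt b) + sqrt 2 * t) / sqrt 2)\<^sup>2)) = ennreal (E t) * f (t\<^sup>2)"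
      by (simp add: dens[symmetric] ennreal_mult ac_simps)
  qed
  also have "\<dots> = (\<integral>\<^sup>+t. (ennreal (E t) * f (t\<^sup>2) + ennreal (E (- t)) * f ((- t)\<^sup>2)) * indicator {0..} t \<partial>lborel)"
    by (rule nn_integral_lborel_fold) measurable
  also have "\<dots> = (\<integral>\<^sup>+t. ennreal (?K (t\<^sup>2)) * f (t\<^sup>2) * ennreal (2 * t) * indicator {0..} t \<partial>lborel)"
  proof (rule nn_integral_cong_AE, rule eventually_mono[OF AE_lborel_singleton[of 0]])
    fix t :: real assume "t \<noteq> 0"
    show "(ennreal (E t) * f (t\<^sup>2) + ennreal (E (- t)) * f ((- t)\<^sup>2)) * indicator {0..} t =
        ennreal (?K (t\<^sup>2)) * f (t\<^sup>2) * ennreal (2 * t) * indicator {0..} t"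
    proof (cases "t > 0")
      case True
      have "ennreal (E t) * f (t\<^sup>2) + ennreal (E (- t)) * f (t\<^sup>2) = ennreal (?K (t\<^sup>2) * (2 * t)) * f (t\<^sup>2)"
        using E0 by (simp add: fold[OF True, symmetric] distrib_right)
      then show ?thesis
        using True K0[of "t\<^sup>2"] by (simp add: ennreal_mult ac_simps)
    next
      case False
      then show ?thesis using \<open>t \<noteq> 0\<close> by (simp add: indicator_def)
    qed
  qed
  also have "\<dots> = (\<integral>\<^sup>+u. ennreal (?K u) * f u * indicator {0..} u \<partial>lborel)"
    by (rule nn_integral_square_substitution[symmetric]) measurable
  also have "\<dots> = (\<integral>\<^sup>+u. ennreal (exp (- b)) * ennreal (gamma_density (1/2) 1 u * hyp01 (1/2) (b * u)) * f u \<partial>lborel)"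
    by (intro nn_integral_cong)
       (auto simp: indicator_def ennreal_mult' not_le)
  finally show ?thesis .
qed

lemma sets_gamma_law [simp, measurable_cong]: "sets (gamma_law a b) = sets borel"
  by (simp add: gamma_law_def)

lemma nn_integral_gamma_law:
  assumes "a > 0" and [measurable]: "f \<in> borel_measurable borel"
  shows "(\<integral>\<^sup>+x. f x \<partial>gamma_law a b) = (\<integral>\<^sup>+x. ennreal (gamma_density a b x) * f x \<partial>lborel)"
  using assms(1) by (simp add: gamma_law_def nn_integral_density)

text \<open>
Adding an independent gamma variable of shape \<open>a - 1/2\<close> only raises the shape of the noncentral law
from \<open>1/2\<close> to \<open>a\<close>.  For \<open>a = 1/2\<close> the added variable is the constant \<open>0\<close>.
\<close>
lemma nn_integral_quadratic_gamma_noise: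
  fixes f :: "real \<Rightarrow> ennreal"
  assumes a: "a \<ge> 1/2" and l: "l > 0" and b: "b \<ge> 0" and [measurable]: "f \<in> borel_measurable borel"
  shows "(\<integral>\<^sup>+g. (\<integral>\<^sup>+n. ennreal (std_normal_density n) * f (l * g + (sqrt b + n / sqrt 2)\<^sup>2) \<partial>lborel)
            \<partial>gamma_law (a - 1/2) l) =
         ennreal (exp (- b)) * (\<integral>\<^sup>+u. ennreal (gamma_density a 1 u * hyp01 a (b * u)) * f u \<partial>lborel)"
proof -
  let ?k = "\<lambda>u. ennreal (gamma_density (1/2) 1 u * hyp01 (1/2) (b * u))"
  have inner: "(\<integral>\<^sup>+n. ennreal (std_normal_density n) * f (l * g + (sqrt b + n / sqrt 2)\<^sup>2) \<partial>lborel) =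
      ennreal (exp (- b)) * (\<integral>\<^sup>+u. ?k u * f (l * g + u) \<partial>lborel)" for g
    using nn_integral_noncentral_gaussian_square[OF b, of "\<lambda>u. f (l * g + u)"]
    by (subst nn_integral_cmult[symmetric]) (auto simp: mult.assoc)
  show ?thesis
  proof (cases "a = 1/2")
    case True
    show ?thesis
      unfolding inner True by (simp add: gamma_law_def nn_integral_return)
  next
    case False
    then have p: "a - 1/2 > 0" using a by simp
    have "(\<integral>\<^sup>+g. ennreal (exp (- b)) * (\<integral>\<^sup>+u. ?k u * f (l * g + u) \<partial>lborel) \<partial>gamma_law (a - 1/2) l) =
        ennreal (exp (- b)) * (\<integral>\<^sup>+g. (\<integral>\<^sup>+u. ?k u * f (l * g + u) \<partial>lborel) \<partial>gamma_law (a - 1/2) l)"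
      by (rule nn_integral_cmult) measurable
    also have "(\<integral>\<^sup>+g. (\<integral>\<^sup>+u. ?k u * f (l * g + u) \<partial>lborel) \<partial>gamma_law (a - 1/2) l) =
        (\<integral>\<^sup>+g. ennreal (gamma_density (a - 1/2) l g) * (\<integral>\<^sup>+u. ?k u * f (l * g + u) \<partial>lborel) \<partial>lborel)"
      by (rule nn_integral_gamma_law[OF p]) measurable
    also have "\<dots> = (\<integral>\<^sup>+g. ennreal (gamma_density (a - 1/2) 1 g) * (\<integral>\<^sup>+u. ?k u * f (l * (g / l) + u) \<partial>lborel) \<partial>lborel)"
      by (rule nn_integral_gamma_density_scale[OF p l]) measurable
    also have "\<dots> = (\<integral>\<^sup>+u. ennreal (gamma_density (a - 1/2 + 1/2) 1 u * hyp01 (a - 1/2 + 1/2) (b * u)) * f u \<partial>lborel)"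
      using l nn_integral_gamma_plus_hyp01[OF p _ b, of "1/2" f] by simp
    finally show ?thesis
      unfolding inner by simp
  qed
qed

text \<open>
The relation \<open>indep_var\<close> compares variables of one common type only, so \<open>X\<close> and the pair
\<open>(G, N)\<close> are first separated as restrictions of one function on indices.
\<close>
lemma (in prob_space) nn_integral_indep_triple:
  fixes X G N :: "'a \<Rightarrow> real" and f :: "real \<times> real \<times> real \<Rightarrow> ennreal"
  assumes ind: "indep_vars (\<lambda>_. borel) (\<lambda>i. [X, G, N] ! i) {..<3::nat}"
    and [measurable]: "f \<in> borel_measurable (borel \<Otimes>\<^sub>M borel \<Otimes>\<^sub>M borel)"
  shows "(\<integral>\<^sup>+\<omega>. f (X \<omega>, G \<omega>, N \<omega>) \<partial>M) =
    (\<integral>\<^sup>+x. (\<integral>\<^sup>+g. (\<integral>\<^sup>+n. f (x, g, n) \<partial>distr M borel N) \<partial>distr M borel G) \<partial>distr M borel X)"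
proof -
  have rv: "random_variable borel ([X, G, N] ! i)" if "i \<in> {..<3}" for i
    using ind that by (auto simp: indep_vars_def)
  have [measurable]: "random_variable borel X" "random_variable borel G" "random_variable borel N"
    using rv[of 0] rv[of 1] rv[of 2] by auto
  interpret PX: prob_space "distr M borel X" by (rule prob_space_distr) measurable
  interpret PG: prob_space "distr M borel G" by (rule prob_space_distr) measurable
  interpret PN: prob_space "distr M borel N" by (rule prob_space_distr) measurable
  let ?A = "\<lambda>\<omega>. restrict (\<lambda>i. ([X, G, N] ! i) \<omega>) {0::nat}"
  let ?B = "\<lambda>\<omega>. restrict (\<lambda>i. ([X, G, N] ! i) \<omega>) {1::nat, 2}"
  have "indep_var (PiM {0} (\<lambda>_. borel)) ?A (PiM {1, 2} (\<lambda>_. borel)) ?B"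
    by (rule indep_var_restrict[OF ind]) auto
  then have joint1: "distr M (PiM {0} (\<lambda>_. borel) \<Otimes>\<^sub>M PiM {1, 2} (\<lambda>_. borel)) (\<lambda>\<omega>. (?A \<omega>, ?B \<omega>)) =
      distr M (PiM {0} (\<lambda>_. borel)) ?A \<Otimes>\<^sub>M distr M (PiM {1, 2} (\<lambda>_. borel)) ?B"
    and [measurable]: "random_variable (PiM {0} (\<lambda>_. borel)) ?A" "random_variable (PiM {1, 2} (\<lambda>_. borel)) ?B"
    unfolding indep_var_distribution_eq by auto
  interpret PB: prob_space "distr M (PiM {1, 2} (\<lambda>_. borel)) ?B" by (rule prob_space_distr) measurable
  have "indep_var (PiM {1} (\<lambda>_. borel)) (\<lambda>\<omega>. restrict (\<lambda>i. ([X, G, N] ! i) \<omega>) {1})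
           (PiM {2} (\<lambda>_. borel)) (\<lambda>\<omega>. restrict (\<lambda>i. ([X, G, N] ! i) \<omega>) {2})"
    by (rule indep_var_restrict[OF ind]) auto
  then have "indep_var borel ((\<lambda>h. h (1::nat)) \<circ> (\<lambda>\<omega>. restrict (\<lambda>i. ([X, G, N] ! i) \<omega>) {1}))
       borel ((\<lambda>h. h (2::nat)) \<circ> (\<lambda>\<omega>. restrict (\<lambda>i. ([X, G, N] ! i) \<omega>) {2}))"
    by (rule indep_var_compose) (auto intro!: measurable_component_singleton)
  then have i2: "indep_var borel G borel N"
    by (simp add: comp_def)
  have joint2: "distr M (borel \<Otimes>\<^sub>M borel) (\<lambda>\<omega>. (G \<omega>, N \<omega>)) = distr M borel G \<Otimes>\<^sub>M distr M borel N"
    using i2 unfolding indep_var_distribution_eq by simp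
  let ?F = "\<lambda>(h, k). f (h (0::nat), k (1::nat), k 2)"
  have [measurable]: "?F \<in> borel_measurable (PiM {0} (\<lambda>_. borel) \<Otimes>\<^sub>M PiM {1, 2} (\<lambda>_. borel))"
    by measurable
  have "(\<integral>\<^sup>+\<omega>. f (X \<omega>, G \<omega>, N \<omega>) \<partial>M) = (\<integral>\<^sup>+\<omega>. ?F (?A \<omega>, ?B \<omega>) \<partial>M)"
    by simp
  also have "\<dots> = (\<integral>\<^sup>+z. ?F z \<partial>distr M (PiM {0} (\<lambda>_. borel) \<Otimes>\<^sub>M PiM {1, 2} (\<lambda>_. borel)) (\<lambda>\<omega>. (?A \<omega>, ?B \<omega>)))"
    by (rule nn_integral_distr[symmetric]) measurable
  also have "\<dots> = (\<integral>\<^sup>+h. (\<integral>\<^sup>+k. ?F (h, k) \<partial>distr M (PiM {1, 2} (\<lambda>_. borel)) ?B)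
      \<partial>distr M (PiM {0} (\<lambda>_. borel)) ?A)"
    unfolding joint1 by (rule PB.nn_integral_fst[symmetric]) measurable
  also have "\<dots> = (\<integral>\<^sup>+\<omega>. (\<integral>\<^sup>+k. ?F (?A \<omega>, k) \<partial>distr M (PiM {1, 2} (\<lambda>_. borel)) ?B) \<partial>M)"
    by (rule nn_integral_distr) measurable
  also have "\<dots> = (\<integral>\<^sup>+\<omega>. (\<integral>\<^sup>+\<omega>'. ?F (?A \<omega>, ?B \<omega>') \<partial>M) \<partial>M)"
    by (intro nn_integral_cong nn_integral_distr) measurable
  also have "\<dots> = (\<integral>\<^sup>+\<omega>. (\<integral>\<^sup>+\<omega>'. f (X \<omega>, G \<omega>', N \<omega>') \<partial>M) \<partial>M)"
    by simp
  also have "\<dots> = (\<integral>\<^sup>+\<omega>. (\<integral>\<^sup>+z. f (X \<omega>, z) \<partial>(distr M borel G \<Otimes>\<^sub>M distr M borel N)) \<partial>M)"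
    unfolding joint2[symmetric] by (subst nn_integral_distr) auto
  also have "\<dots> = (\<integral>\<^sup>+\<omega>. (\<integral>\<^sup>+g. (\<integral>\<^sup>+n. f (X \<omega>, g, n) \<partial>distr M borel N) \<partial>distr M borel G) \<partial>M)"
    by (subst PN.nn_integral_fst[symmetric]) auto
  also have "\<dots> = (\<integral>\<^sup>+x. (\<integral>\<^sup>+g. (\<integral>\<^sup>+n. f (x, g, n) \<partial>distr M borel N) \<partial>distr M borel G) \<partial>distr M borel X)"
    by (subst nn_integral_distr) auto
  finally show ?thesis .
qed

text \<open>
In the scaled variables \<open>\<nu> X\<close> and \<open>l X\<^sub>r\<close> the joint law depends on \<open>\<nu>\<close>, \<open>l\<close>, \<open>r\<close> only
through \<open>s = l r / \<nu>\<close>.  This is why a general rate \<open>\<nu>\<close> costs nothing more than \<open>\<nu> = l\<close>.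
\<close>
lemma (in prob_space) nn_integral_quadratic_gamma_channel:
  fixes X G N :: "'a \<Rightarrow> real" and f :: "real \<times> real \<Rightarrow> ennreal"
  assumes a: "a \<ge> 1/2" and l: "l > 0" and \<nu>: "\<nu> > 0" and r: "r \<ge> 0"
    and ind: "indep_vars (\<lambda>_. borel) (\<lambda>i. [X, G, N] ! i) {..<3::nat}"
    and X: "distr M borel X = gamma_law a \<nu>"
    and G: "distr M borel G = gamma_law (a - 1/2) l"
    and N: "distributed M lborel N (\<lambda>x. ennreal (std_normal_density x))"
    and [measurable]: "f \<in> borel_measurable (borel \<Otimes>\<^sub>M borel)"
  defines "s \<equiv> l * r / \<nu>"
  shows "(\<integral>\<^sup>+\<omega>. f (\<nu> * X \<omega>, l * quadratic_gamma_output l G N X r \<omega>) \<partial>M) =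
    (\<integral>\<^sup>+v. ennreal (gamma_density a 1 v) * (ennreal (exp (- (s * v))) *
        (\<integral>\<^sup>+u. ennreal (gamma_density a 1 u * hyp01 a (s * v * u)) * f (v, u) \<partial>lborel)) \<partial>lborel)"
proof -
  have PN: "distr M borel N = density lborel (\<lambda>x. ennreal (std_normal_density x))"
    using N by (simp add: distributed_def cong: distr_cong)
  have "(\<integral>\<^sup>+\<omega>. f (\<nu> * X \<omega>, l * quadratic_gamma_output l G N X r \<omega>) \<partial>M) =
      (\<integral>\<^sup>+\<omega>. (\<lambda>(x, g, n). f (\<nu> * x, l * (g + (sqrt (r * x) + n / sqrt (2 * l))\<^sup>2))) (X \<omega>, G \<omega>, N \<omega>) \<partial>M)"
    by (simp add: quadratic_gamma_output_def)
  also have "\<dots> = (\<integral>\<^sup>+x. (\<integral>\<^sup>+g. (\<integral>\<^sup>+n. f (\<nu> * x, l * (g + (sqrt (r * x) + n / sqrt (2 * l))\<^sup>2))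
      \<partial>distr M borel N) \<partial>distr M borel G) \<partial>distr M borel X)"
    by (subst nn_integral_indep_triple[OF ind]) auto
  also have "\<dots> = (\<integral>\<^sup>+x. ennreal (gamma_density a \<nu> x) * (\<integral>\<^sup>+g. (\<integral>\<^sup>+n. ennreal (std_normal_density n) *
       f (\<nu> * x, l * (g + (sqrt (r * x) + n / sqrt (2 * l))\<^sup>2)) \<partial>lborel) \<partial>gamma_law (a - 1/2) l) \<partial>lborel)"
  proof -
    have "prob_space (gamma_law (a - 1/2) l)"
      unfolding G[symmetric] using ind
      by (intro prob_space_distr) (auto simp: indep_vars_def dest!: bspec[of _ _ "1::nat"])
    then interpret PG: prob_space "gamma_law (a - 1/2) l" .
    show ?thesis
      unfolding X G PN using a
      by (subst nn_integral_gamma_law) (auto simp: nn_integral_density)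
  qed
  also have "\<dots> = (\<integral>\<^sup>+x. ennreal (gamma_density a \<nu> x) * (ennreal (exp (- (s * (\<nu> * x)))) *
        (\<integral>\<^sup>+u. ennreal (gamma_density a 1 u * hyp01 a (s * (\<nu> * x) * u)) * f (\<nu> * x, u) \<partial>lborel)) \<partial>lborel)"
  proof (rule nn_integral_cong)
    fix x :: real
    show "ennreal (gamma_density a \<nu> x) * (\<integral>\<^sup>+g. (\<integral>\<^sup>+n. ennreal (std_normal_density n) *
       f (\<nu> * x, l * (g + (sqrt (r * x) + n / sqrt (2 * l))\<^sup>2)) \<partial>lborel) \<partial>gamma_law (a - 1/2) l) =
       ennreal (gamma_density a \<nu> x) * (ennreal (exp (- (s * (\<nu> * x)))) *
        (\<integral>\<^sup>+u. ennreal (gamma_density a 1 u * hyp01 a (s * (\<nu> * x) * u)) * f (\<nu> * x, u) \<partial>lborel))"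
    proof (cases "x > 0")
      case True
      have sx: "s * (\<nu> * x) = l * (r * x)" using \<nu> by (simp add: s_def)
      have e: "l * (g + (sqrt (r * x) + n / sqrt (2 * l))\<^sup>2) = l * g + (sqrt (l * (r * x)) + n / sqrt 2)\<^sup>2" for g n
      proof -
        have "sqrt (l * (r * x)) + n / sqrt 2 = sqrt l * (sqrt (r * x) + n / sqrt (2 * l))"
          using l by (simp add: real_sqrt_mult field_simps)
        then have "(sqrt (l * (r * x)) + n / sqrt 2)\<^sup>2 = l * (sqrt (r * x) + n / sqrt (2 * l))\<^sup>2"
          using l by (simp only: power_mult_distrib) simp
        then show ?thesis by (simp only: distrib_left)
      qed
      show ?thesis
        unfolding e sx using a l r True
        by (subst nn_integral_quadratic_gamma_noise[where f = "\<lambda>u. f (\<nu> * x, u)"]) auto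
    qed simp
  qed
  also have "\<dots> = (\<integral>\<^sup>+v. ennreal (gamma_density a 1 v) * (ennreal (exp (- (s * (\<nu> * (v / \<nu>))))) *
        (\<integral>\<^sup>+u. ennreal (gamma_density a 1 u * hyp01 a (s * (\<nu> * (v / \<nu>)) * u)) * f (\<nu> * (v / \<nu>), u) \<partial>lborel)) \<partial>lborel)"
    using a by (intro nn_integral_gamma_density_scale \<nu>) auto
  finally show ?thesis using \<nu> by simp
qed

section \<open>Density of the joint law and the mutual information\<close>

text \<open>
Radon-Nikodym derivatives are unique almost everywhere, so any concrete density of the joint law may
replace the abstract one, both in the integral and in the integrability condition.
\<close>
lemma (in prob_space) mutual_info_density:
  fixes X Y :: "'a \<Rightarrow> real" and \<rho> :: "real \<times> real \<Rightarrow> real"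
  assumes [measurable]: "random_variable borel X" "random_variable borel Y"
    "\<rho> \<in> borel_measurable (borel \<Otimes>\<^sub>M borel)"
    and pos: "\<And>z. \<rho> z \<ge> 0"
    and joint: "distr M (borel \<Otimes>\<^sub>M borel) (\<lambda>\<omega>. (X \<omega>, Y \<omega>)) =
      density (distr M borel X \<Otimes>\<^sub>M distr M borel Y) (\<lambda>z. ennreal (\<rho> z))"
  shows "mutual_info_finite M X Y \<longleftrightarrow> integrable M (\<lambda>\<omega>. ln (\<rho> (X \<omega>, Y \<omega>)))"
    and "mutual_info M X Y = (\<integral>\<omega>. ln (\<rho> (X \<omega>, Y \<omega>)) \<partial>M)"
proof -
  let ?P = "distr M borel X \<Otimes>\<^sub>M distr M borel Y"
  let ?J = "distr M (borel \<Otimes>\<^sub>M borel) (\<lambda>\<omega>. (X \<omega>, Y \<omega>))"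
  interpret PX: prob_space "distr M borel X" by (rule prob_space_distr) measurable
  interpret PY: prob_space "distr M borel Y" by (rule prob_space_distr) measurable
  interpret P: pair_prob_space "distr M borel X" "distr M borel Y" ..
  have "AE z in ?P. ennreal (\<rho> z) = RN_deriv ?P ?J z"
    by (rule P.RN_deriv_unique) (auto simp: joint)
  then have "AE z in ?P. entropy_density (exp 1) ?P ?J z = ln (\<rho> z)"
    by (rule eventually_mono) (auto simp: entropy_density_def log_def pos dest: sym)
  then have ae: "AE z in ?J. entropy_density (exp 1) ?P ?J z = ln (\<rho> z)"
    unfolding joint by (subst AE_density) auto
  have [measurable]: "entropy_density (exp 1) ?P ?J \<in> borel_measurable (borel \<Otimes>\<^sub>M borel)"
    using measurable_entropy_density[of "exp 1" ?P ?J]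
    by (simp cong: measurable_cong_sets)
  have ac: "absolutely_continuous ?P ?J"
    unfolding joint by (rule absolutely_continuousI_density) measurable
  have "integrable ?J (entropy_density (exp 1) ?P ?J) \<longleftrightarrow> integrable ?J (\<lambda>z. ln (\<rho> z))"
    by (rule integrable_cong_AE) (use ae in auto)
  also have "\<dots> \<longleftrightarrow> integrable M (\<lambda>\<omega>. ln (\<rho> (X \<omega>, Y \<omega>)))"
    by (rule integrable_distr_eq) measurable
  finally show "mutual_info_finite M X Y \<longleftrightarrow> integrable M (\<lambda>\<omega>. ln (\<rho> (X \<omega>, Y \<omega>)))"
    using ac by (simp add: mutual_info_finite_def Let_def)
  have "mutual_info M X Y = integral\<^sup>L ?J (\<lambda>z. ln (\<rho> z))"
    unfolding mutual_information_def KL_divergence_def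
    by (rule integral_cong_AE) (use ae in auto)
  also have "\<dots> = (\<integral>\<omega>. ln (\<rho> (X \<omega>, Y \<omega>)) \<partial>M)"
    by (rule integral_distr) measurable
  finally show "mutual_info M X Y = (\<integral>\<omega>. ln (\<rho> (X \<omega>, Y \<omega>)) \<partial>M)" .
qed

lemma gamma_density_tilt:
  assumes "0 < b"
  shows "gamma_density a b x = b powr a * exp ((1 - b) * x) * gamma_density a 1 x"
  using assms by (simp add: gamma_density_def mult_exp_exp algebra_simps)

lemma (in prob_space) gamma_expectation:
  fixes Z :: "'a \<Rightarrow> real"
  assumes [measurable]: "random_variable borel Z" and a: "a > 0" and b: "b > 0"
    and law: "\<And>f :: real \<Rightarrow> ennreal. f \<in> borel_measurable borel \<Longrightarrow>
      (\<integral>\<^sup>+\<omega>. f (Z \<omega>) \<partial>M) = (\<integral>\<^sup>+v. ennreal (gamma_density a b v) * f v \<partial>lborel)"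
  shows "has_bochner_integral M Z (a / b)"
proof (rule has_bochner_integral_nn_integral)
  have "ennreal (gamma_density a b v) * indicator {..<0} v = 0" for v
    by (cases "v > 0") auto
  then have "(\<integral>\<^sup>+\<omega>. indicator {..<0} (Z \<omega>) \<partial>M) = 0"
    using law[of "indicator {..<0}"] by (simp del: mult_eq_0_iff)
  then have "AE \<omega> in M. indicator {..<0} (Z \<omega>) = (0::ennreal)"
    by (subst (asm) nn_integral_0_iff_AE) auto
  then show "AE \<omega> in M. 0 \<le> Z \<omega>"
    by eventually_elim (auto simp: indicator_def split: if_splits)
  have "(\<integral>\<^sup>+\<omega>. ennreal (Z \<omega>) \<partial>M) = (\<integral>\<^sup>+v. ennreal (gamma_density a 1 v) * ennreal (v / b) \<partial>lborel)"
    using law[of ennreal] by (simp add: nn_integral_gamma_density_scale[OF a b])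
  also have "\<dots> = (\<integral>\<^sup>+v. ennreal (a / b) * ennreal (gamma_density (a + 1) 1 v) \<partial>lborel)"
  proof (rule nn_integral_cong)
    fix v
    have "gamma_density a 1 v * (v / b) = a / b * gamma_density (a + 1) 1 v"
      using times_gamma_density[OF a, of v] by (simp add: mult.commute)
    then show "ennreal (gamma_density a 1 v) * ennreal (v / b) = ennreal (a / b) * ennreal (gamma_density (a + 1) 1 v)"
      using a b by (simp add: ennreal_mult'[symmetric] gamma_density_nonneg)
  qed
  also have "\<dots> = ennreal (a / b)"
    using a by (simp add: nn_integral_cmult nn_integral_gamma_density_1)
  finally show "(\<integral>\<^sup>+\<omega>. ennreal (Z \<omega>) \<partial>M) = ennreal (a / b)" .
qed (use a b in auto)

text \<open>
The output of the channel with a gamma input is again gamma distributed.  The transition density is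
symmetric in \<open>u\<close> and \<open>v\<close> apart from the exponential factors, so integrating out \<open>v\<close> is the
normalisation \<open>nn_integral_gamma_density_hyp01\<close> with \<open>u\<close> as the parameter.
\<close>
lemma nn_integral_gamma_mixed_marginal:
  fixes f :: "real \<Rightarrow> ennreal"
  assumes a: "a > 0" and s: "s \<ge> 0" and [measurable]: "f \<in> borel_measurable borel"
  shows "(\<integral>\<^sup>+v. ennreal (gamma_density a 1 v) * (ennreal (exp (- (s * v))) *
        (\<integral>\<^sup>+u. ennreal (gamma_density a 1 u * hyp01 a (s * v * u)) * f u \<partial>lborel)) \<partial>lborel) =
      (\<integral>\<^sup>+u. ennreal (gamma_density a (1 / (1 + s)) u) * f u \<partial>lborel)"
proof -
  let ?c = "(1 / (1 + s)) powr a"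
  let ?k = "\<lambda>v u. ennreal (gamma_density a 1 v) * (ennreal (exp (- (s * v))) *
        (ennreal (gamma_density a 1 u * hyp01 a (s * v * u)) * f u))"
  have "(\<integral>\<^sup>+v. ennreal (gamma_density a 1 v) * (ennreal (exp (- (s * v))) *
        (\<integral>\<^sup>+u. ennreal (gamma_density a 1 u * hyp01 a (s * v * u)) * f u \<partial>lborel)) \<partial>lborel) =
      (\<integral>\<^sup>+v. (\<integral>\<^sup>+u. ?k v u \<partial>lborel) \<partial>lborel)"
    by (simp add: nn_integral_cmult)
  also have "\<dots> = (\<integral>\<^sup>+u. (\<integral>\<^sup>+v. ?k v u \<partial>lborel) \<partial>lborel)"
    by (rule lborel_pair.Fubini') measurable
  also have "\<dots> = (\<integral>\<^sup>+u. ennreal (gamma_density a (1 / (1 + s)) u) * f u \<partial>lborel)"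
  proof (rule nn_integral_cong)
    fix u :: real
    show "(\<integral>\<^sup>+v. ?k v u \<partial>lborel) = ennreal (gamma_density a (1 / (1 + s)) u) * f u"
    proof (cases "u > 0")
      case u: True
      let ?b = "s * u / (1 + s)"
      let ?g = "ennreal ((1 + s) powr (- a)) * ennreal (gamma_density a 1 u) * f u"
      have b: "?b \<ge> 0" using u s by simp
      have "(\<integral>\<^sup>+v. ?k v u \<partial>lborel) =
         (\<integral>\<^sup>+v. ?g * (ennreal (gamma_density a (1 + s) v) * ennreal (hyp01 a (s * v * u))) \<partial>lborel)"
      proof (rule nn_integral_cong)
        fix v :: real
        show "?k v u = ?g * (ennreal (gamma_density a (1 + s) v) * ennreal (hyp01 a (s * v * u)))"
        proof (cases "v > 0")
          case v: True
          have 1: "gamma_density a 1 v * exp (- (s * v)) = (1 + s) powr (- a) * gamma_density a (1 + s) v"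
            using s by (subst gamma_density_tilt[of "1 + s"]) (auto simp: powr_minus)
          have "ennreal (gamma_density a 1 v) * ennreal (exp (- (s * v))) =
              ennreal ((1 + s) powr (- a)) * ennreal (gamma_density a (1 + s) v)"
            using a by (simp add: ennreal_mult[symmetric] gamma_density_nonneg 1)
          moreover have "ennreal (gamma_density a 1 u * hyp01 a (s * v * u)) =
              ennreal (gamma_density a 1 u) * ennreal (hyp01 a (s * v * u))"
            using a by (simp add: ennreal_mult' gamma_density_nonneg)
          ultimately show ?thesis
            by (simp only: mult.assoc[symmetric]) (simp only: ac_simps)
        qed simp
      qed
      also have "\<dots> = ?g * (\<integral>\<^sup>+v. ennreal (gamma_density a (1 + s) v) * ennreal (hyp01 a (s * v * u)) \<partial>lborel)"
        by (rule nn_integral_cmult) measurable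
      also have "(\<integral>\<^sup>+v. ennreal (gamma_density a (1 + s) v) * ennreal (hyp01 a (s * v * u)) \<partial>lborel) =
          (\<integral>\<^sup>+w. ennreal (gamma_density a 1 w) * ennreal (hyp01 a (s * (w / (1 + s)) * u)) \<partial>lborel)"
        using s by (intro nn_integral_gamma_density_scale[OF a]) auto
      also have "\<dots> = (\<integral>\<^sup>+w. ennreal (gamma_density a 1 w * hyp01 a (?b * w)) \<partial>lborel)"
        using a by (intro nn_integral_cong) (auto simp: ennreal_mult' gamma_density_nonneg ac_simps)
      also have "\<dots> = ennreal (exp ?b)"
        by (rule nn_integral_gamma_density_hyp01[OF a b])
      also have "?g * ennreal (exp ?b) = ennreal ((1 + s) powr (- a) * gamma_density a 1 u * exp ?b) * f u"
        using a by (simp add: ennreal_mult gamma_density_nonneg ac_simps)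
      also have "(1 + s) powr (- a) * gamma_density a 1 u * exp ?b = gamma_density a (1 / (1 + s)) u"
      proof -
        have "(1 - 1 / (1 + s)) * u = ?b" using s by (simp add: field_simps)
        then show ?thesis
          using s by (subst gamma_density_tilt[of "1 / (1 + s)"]) (auto simp: powr_minus powr_divide divide_simps)
      qed
      finally show ?thesis .
    qed simp
  qed
  finally show ?thesis .
qed

text \<open>
The density of the joint law of the scaled input \<open>v\<close> and output \<open>u\<close> with respect to the product of
its marginals.  The absolute value changes nothing on the support and makes the ratio positive
everywhere.
\<close>
definition channel_density_ratio :: "real \<Rightarrow> real \<Rightarrow> real \<times> real \<Rightarrow> real" where
  "channel_density_ratio a s = (\<lambda>(v, u).
     (1 + s) powr a * exp (- (s * v) - s / (1 + s) * u) * hyp01 a (s * \<bar>v * u\<bar>))"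

lemma channel_density_ratio_measurable [measurable]:
  "channel_density_ratio a s \<in> borel_measurable (borel \<Otimes>\<^sub>M borel)"
  unfolding channel_density_ratio_def by measurable

lemma channel_density_ratio_pos:
  "a > 0 \<Longrightarrow> s \<ge> 0 \<Longrightarrow> channel_density_ratio a s z > 0"
  using hyp01_pos[of a] by (auto simp: channel_density_ratio_def split: prod.split intro!: mult_pos_pos)

lemma ln_channel_density_ratio:
  assumes "a > 0" "s \<ge> 0"
  shows "ln (channel_density_ratio a s (v, u)) =
    a * ln (1 + s) - s * v - s / (1 + s) * u + ln (hyp01 a (s * \<bar>v * u\<bar>))"
  using assms hyp01_pos[of a "s * \<bar>v * u\<bar>"]
  by (simp add: channel_density_ratio_def ln_mult)

lemma channel_density_ratio_times_marginal:
  assumes "a > 0" "s \<ge> 0" "v > 0"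
  shows "gamma_density a (1 / (1 + s)) u * channel_density_ratio a s (v, u) =
    exp (- (s * v)) * (gamma_density a 1 u * hyp01 a (s * v * u))"
proof (cases "u > 0")
  case True
  have "(1 - 1 / (1 + s)) * u = s / (1 + s) * u" using assms by (simp add: field_simps)
  then have tilt: "gamma_density a (1 / (1 + s)) u = (1 + s) powr (- a) * exp (s / (1 + s) * u) * gamma_density a 1 u"
    using assms by (subst gamma_density_tilt) (auto simp: powr_minus powr_divide divide_simps)
  have 1: "(1 + s) powr (- a) * (1 + s) powr a = 1"
    using assms by (simp add: powr_minus)
  have 2: "exp (s / (1 + s) * u) * exp (- (s * v) - s / (1 + s) * u) = exp (- (s * v))"
    by (simp add: mult_exp_exp)
  have 3: "s * \<bar>v * u\<bar> = s * v * u" using True assms by simp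
  have "gamma_density a (1 / (1 + s)) u * channel_density_ratio a s (v, u) =
      ((1 + s) powr (- a) * (1 + s) powr a) * (exp (s / (1 + s) * u) * exp (- (s * v) - s / (1 + s) * u)) *
      (gamma_density a 1 u * hyp01 a (s * \<bar>v * u\<bar>))"
    unfolding channel_density_ratio_def prod.case tilt by (simp only: ac_simps)
  then show ?thesis
    unfolding 1 2 3 by simp
qed simp

text \<open>
The locale fixes one value of \<open>r\<close>; the dependence on \<open>r\<close> is recovered afterwards from
the closed formula \<open>mutual_info_formula\<close>, in which \<open>r\<close> occurs only through \<open>s\<close>.
\<close>
locale quadratic_gamma_channel = prob_space M for M :: "'a measure" +
  fixes X G N :: "'a \<Rightarrow> real" and a l \<nu> r :: real
  assumes a: "a \<ge> 1/2" and l: "l > 0" and \<nu>: "\<nu> > 0" and r: "r \<ge> 0"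
    and ind: "indep_vars (\<lambda>_. borel) (\<lambda>i. [X, G, N] ! i) {..<3::nat}"
    and X_law: "distr M borel X = gamma_law a \<nu>"
    and G_law: "distr M borel G = gamma_law (a - 1/2) l"
    and N_law: "distributed M lborel N (\<lambda>x. ennreal (std_normal_density x))"
begin

definition s :: real where "s = l * r / \<nu>"

abbreviation Y :: "'a \<Rightarrow> real" where "Y \<equiv> quadratic_gamma_output l G N X r"

lemma s_nonneg: "s \<ge> 0"
  using l \<nu> r by (simp add: s_def)

lemma a_pos: "a > 0"
  using a by simp

lemma rv [measurable]: "random_variable borel X" "random_variable borel G" "random_variable borel N"
proof -
  have "random_variable borel ([X, G, N] ! i)" if "i \<in> {..<3}" for i
    using ind that by (auto simp: indep_vars_def)
  from this[of 0] this[of 1] this[of 2]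
  show "random_variable borel X" "random_variable borel G" "random_variable borel N" by auto
qed

lemma rv_Y [measurable]: "random_variable borel Y"
  unfolding quadratic_gamma_output_def by measurable

lemma nn_integral_joint:
  fixes f :: "real \<times> real \<Rightarrow> ennreal"
  assumes "f \<in> borel_measurable (borel \<Otimes>\<^sub>M borel)"
  shows "(\<integral>\<^sup>+\<omega>. f (\<nu> * X \<omega>, l * Y \<omega>) \<partial>M) =
    (\<integral>\<^sup>+v. ennreal (gamma_density a 1 v) * (ennreal (exp (- (s * v))) *
        (\<integral>\<^sup>+u. ennreal (gamma_density a 1 u * hyp01 a (s * v * u)) * f (v, u) \<partial>lborel)) \<partial>lborel)"
  unfolding s_def by (rule nn_integral_quadratic_gamma_channel[OF a l \<nu> r ind X_law G_law N_law assms])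

lemma nn_integral_input:
  fixes f :: "real \<Rightarrow> ennreal"
  assumes [measurable]: "f \<in> borel_measurable borel"
  shows "(\<integral>\<^sup>+\<omega>. f (\<nu> * X \<omega>) \<partial>M) = (\<integral>\<^sup>+v. ennreal (gamma_density a 1 v) * f v \<partial>lborel)"
proof -
  have "(\<integral>\<^sup>+\<omega>. f (\<nu> * X \<omega>) \<partial>M) = (\<integral>\<^sup>+x. f (\<nu> * x) \<partial>gamma_law a \<nu>)"
    unfolding X_law[symmetric] by (subst nn_integral_distr) auto
  also have "\<dots> = (\<integral>\<^sup>+x. ennreal (gamma_density a \<nu> x) * f (\<nu> * x) \<partial>lborel)"
    using a_pos by (rule nn_integral_gamma_law) measurable
  also have "\<dots> = (\<integral>\<^sup>+v. ennreal (gamma_density a 1 v) * f (\<nu> * (v / \<nu>)) \<partial>lborel)"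
    using a_pos \<nu> by (rule nn_integral_gamma_density_scale) measurable
  finally show ?thesis using \<nu> by simp
qed

lemma nn_integral_output:
  fixes f :: "real \<Rightarrow> ennreal"
  assumes [measurable]: "f \<in> borel_measurable borel"
  shows "(\<integral>\<^sup>+\<omega>. f (l * Y \<omega>) \<partial>M) = (\<integral>\<^sup>+u. ennreal (gamma_density a (1 / (1 + s)) u) * f u \<partial>lborel)"
  using nn_integral_joint[of "\<lambda>z. f (snd z)"] nn_integral_gamma_mixed_marginal[OF a_pos s_nonneg assms]
  by simp

text \<open>
Both sides are reduced to integrals over \<open>v\<close> and \<open>u\<close>: the right-hand side by integrating over two
independent copies of the probability space, the left-hand side by the channel law.
\<close>
lemma joint_law_density:
  "distr M (borel \<Otimes>\<^sub>M borel) (\<lambda>\<omega>. (X \<omega>, Y \<omega>)) =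
   density (distr M borel X \<Otimes>\<^sub>M distr M borel Y)
     (\<lambda>(x, y). ennreal (channel_density_ratio a s (\<nu> * x, l * y)))"
proof (rule measure_eqI)
  interpret PY: prob_space "distr M borel Y" by (rule prob_space_distr) measurable
  fix A assume "A \<in> sets (distr M (borel \<Otimes>\<^sub>M borel) (\<lambda>\<omega>. (X \<omega>, Y \<omega>)))"
  then have [measurable]: "A \<in> sets (borel \<Otimes>\<^sub>M borel)" by simp
  let ?I = "\<lambda>(v, u). indicator A (v / \<nu>, u / l) :: ennreal"
  let ?R = "\<lambda>v u. ennreal (channel_density_ratio a s (v, u))"
  have [measurable]: "?I \<in> borel_measurable (borel \<Otimes>\<^sub>M borel)" by measurable
  have "emeasure (density (distr M borel X \<Otimes>\<^sub>M distr M borel Y)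
     (\<lambda>(x, y). ennreal (channel_density_ratio a s (\<nu> * x, l * y)))) A =
     (\<integral>\<^sup>+z. (case z of (x, y) \<Rightarrow> ?R (\<nu> * x) (l * y)) * indicator A z \<partial>(distr M borel X \<Otimes>\<^sub>M distr M borel Y))"
    by (rule emeasure_density) measurable
  also have "\<dots> = (\<integral>\<^sup>+x. (\<integral>\<^sup>+y. ?R (\<nu> * x) (l * y) * indicator A (x, y) \<partial>distr M borel Y) \<partial>distr M borel X)"
    by (subst PY.nn_integral_fst[symmetric]) auto
  also have "\<dots> = (\<integral>\<^sup>+\<omega>. (\<integral>\<^sup>+y. ?R (\<nu> * X \<omega>) (l * y) * indicator A (X \<omega>, y) \<partial>distr M borel Y) \<partial>M)"
    by (rule nn_integral_distr) measurable
  also have "\<dots> = (\<integral>\<^sup>+\<omega>. (\<integral>\<^sup>+\<omega>'. ?R (\<nu> * X \<omega>) (l * Y \<omega>') * indicator A (X \<omega>, Y \<omega>') \<partial>M) \<partial>M)"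
    by (intro nn_integral_cong nn_integral_distr) measurable
  also have "\<dots> = (\<integral>\<^sup>+\<omega>. (\<integral>\<^sup>+\<omega>'. ?R (\<nu> * X \<omega>) (l * Y \<omega>') * ?I (\<nu> * X \<omega>, l * Y \<omega>') \<partial>M) \<partial>M)"
    using \<nu> l by simp
  also have "\<dots> = (\<integral>\<^sup>+\<omega>. (\<integral>\<^sup>+u. ennreal (gamma_density a (1 / (1 + s)) u) *
      (?R (\<nu> * X \<omega>) u * ?I (\<nu> * X \<omega>, u)) \<partial>lborel) \<partial>M)"
    by (intro nn_integral_cong nn_integral_output[where f = "\<lambda>u. ?R _ u * ?I (_, u)"]) measurable
  also have "\<dots> = (\<integral>\<^sup>+v. ennreal (gamma_density a 1 v) * (\<integral>\<^sup>+u. ennreal (gamma_density a (1 / (1 + s)) u) *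
      (?R v u * ?I (v, u)) \<partial>lborel) \<partial>lborel)"
    by (rule nn_integral_input) measurable
  also have "\<dots> = (\<integral>\<^sup>+v. ennreal (gamma_density a 1 v) * (ennreal (exp (- (s * v))) *
        (\<integral>\<^sup>+u. ennreal (gamma_density a 1 u * hyp01 a (s * v * u)) * ?I (v, u) \<partial>lborel)) \<partial>lborel)"
  proof (rule nn_integral_cong)
    fix v :: real
    show "ennreal (gamma_density a 1 v) * (\<integral>\<^sup>+u. ennreal (gamma_density a (1 / (1 + s)) u) *
      (?R v u * ?I (v, u)) \<partial>lborel) = ennreal (gamma_density a 1 v) * (ennreal (exp (- (s * v))) *
        (\<integral>\<^sup>+u. ennreal (gamma_density a 1 u * hyp01 a (s * v * u)) * ?I (v, u) \<partial>lborel))"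
    proof (cases "v > 0")
      case True
      have "ennreal (gamma_density a (1 / (1 + s)) u) * ?R v u =
          ennreal (exp (- (s * v))) * ennreal (gamma_density a 1 u * hyp01 a (s * v * u))" for u
        using channel_density_ratio_times_marginal[OF a_pos s_nonneg True, of u] a_pos
          channel_density_ratio_pos[OF a_pos s_nonneg, of "(v, u)"]
        by (metis ennreal_mult' exp_ge_zero gamma_density_nonneg)
      then show ?thesis
        by (subst nn_integral_cmult[symmetric]) (auto simp: mult.assoc[symmetric])
    qed simp
  qed
  also have "\<dots> = (\<integral>\<^sup>+\<omega>. ?I (\<nu> * X \<omega>, l * Y \<omega>) \<partial>M)"
    by (rule nn_integral_joint[symmetric]) measurable
  also have "\<dots> = (\<integral>\<^sup>+\<omega>. indicator A (X \<omega>, Y \<omega>) \<partial>M)"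
    using \<nu> l by simp
  also have "\<dots> = (\<integral>\<^sup>+z. indicator A z \<partial>distr M (borel \<Otimes>\<^sub>M borel) (\<lambda>\<omega>. (X \<omega>, Y \<omega>)))"
    by (rule nn_integral_distr[symmetric]) measurable
  also have "\<dots> = emeasure (distr M (borel \<Otimes>\<^sub>M borel) (\<lambda>\<omega>. (X \<omega>, Y \<omega>))) A"
    by simp
  finally show "emeasure (distr M (borel \<Otimes>\<^sub>M borel) (\<lambda>\<omega>. (X \<omega>, Y \<omega>))) A =
    emeasure (density (distr M borel X \<Otimes>\<^sub>M distr M borel Y)
     (\<lambda>(x, y). ennreal (channel_density_ratio a s (\<nu> * x, l * y)))) A" ..
qed simp

lemma mutual_info_eq_expectation:
  shows "mutual_info_finite M X Y \<longleftrightarrow>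
      integrable M (\<lambda>\<omega>. ln (channel_density_ratio a s (\<nu> * X \<omega>, l * Y \<omega>)))"
    and "mutual_info M X Y = (\<integral>\<omega>. ln (channel_density_ratio a s (\<nu> * X \<omega>, l * Y \<omega>)) \<partial>M)"
  using mutual_info_density[where \<rho> = "\<lambda>(x, y). channel_density_ratio a s (\<nu> * x, l * y)", OF rv(1) rv_Y]
    joint_law_density channel_density_ratio_pos[OF a_pos s_nonneg]
  by (simp_all add: case_prod_beta' less_imp_le)

lemma expectation_input: "has_bochner_integral M (\<lambda>\<omega>. \<nu> * X \<omega>) a"
  using gamma_expectation[of "\<lambda>\<omega>. \<nu> * X \<omega>" a 1] nn_integral_input a_pos by simp

lemma expectation_output: "has_bochner_integral M (\<lambda>\<omega>. l * Y \<omega>) (a * (1 + s))"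
  using gamma_expectation[of "\<lambda>\<omega>. l * Y \<omega>" a "1 / (1 + s)"] nn_integral_output a_pos s_nonneg
  by simp

end

section \<open>Differentiation of the expected log-likelihood\<close>

text \<open>
The difference quotients are dominated by \<open>g\<close> because of the mean value theorem, so this is dominated
convergence.  Measurability of the derivative comes for free, as a limit of difference quotients.
\<close>
lemma has_real_derivative_integral:
  fixes f f' :: "real \<Rightarrow> 'b \<Rightarrow> real"
  assumes x0: "x0 \<in> {lo<..<hi}"
    and int: "\<And>x. x \<in> {lo<..<hi} \<Longrightarrow> integrable M (f x)"
    and der: "\<And>x w. x \<in> {lo<..<hi} \<Longrightarrow> w \<in> space M \<Longrightarrow> ((\<lambda>x. f x w) has_real_derivative f' x w) (at x)"
    and bound: "\<And>x w. x \<in> {lo<..<hi} \<Longrightarrow> w \<in> space M \<Longrightarrow> \<bar>f' x w\<bar> \<le> g w"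
    and g: "integrable M g"
  shows "integrable M (f' x0)"
    and "((\<lambda>x. \<integral>w. f x w \<partial>M) has_real_derivative (\<integral>w. f' x0 w \<partial>M)) (at x0)"
proof -
  let ?I = "{lo<..<hi}"
  let ?Q = "\<lambda>x w. (f x w - f x0 w) / (x - x0)"
  have lim: "(\<lambda>i. ?Q (X i) w) \<longlonglongrightarrow> f' x0 w"
    if "\<And>i. X i \<in> ?I - {x0}" "X \<longlonglongrightarrow> x0" "w \<in> space M" for X w
  proof -
    have "((\<lambda>x. ?Q x w) \<longlongrightarrow> f' x0 w) (at x0 within ?I)"
      using der[OF x0 that(3)] by (subst at_within_open[OF x0]) (auto simp: has_field_derivative_iff)
    then show ?thesis
      using that(1,2) unfolding tendsto_at_iff_sequentially by (auto simp: comp_def)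
  qed
  have Qb: "\<bar>?Q x w\<bar> \<le> g w" if x: "x \<in> ?I - {x0}" and w: "w \<in> space M" for x w
  proof -
    have *: "\<bar>?Q x w\<bar> \<le> g w" if "p < q" "p \<in> ?I" "q \<in> ?I" "{p, q} = {x, x0}" for p q
    proof -
      have "\<exists>z>p. z < q \<and> f q w - f p w = (q - p) * f' z w"
        using that w by (intro MVT2 der) auto
      then obtain z where z: "p < z" "z < q" "f q w - f p w = (q - p) * f' z w" by blast
      have "?Q x w = (f q w - f p w) / (q - p)"
        using that by (auto simp: doubleton_eq_iff divide_simps) (auto simp: algebra_simps)
      also have "\<dots> = f' z w" using z that by simp
      finally show ?thesis using bound[of z w] z that w by auto
    qed
    show ?thesis
      using x x0 *[of x x0] *[of x0 x] by (cases "x < x0") (auto simp: insert_commute)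
  qed
  have Qm: "?Q x \<in> borel_measurable M" if "x \<in> ?I" for x
    using int[OF that] int[OF x0] by (auto intro!: borel_measurable_divide borel_measurable_diff)
  have main: "integrable M (f' x0) \<and> (\<lambda>i. \<integral>w. ?Q (X i) w \<partial>M) \<longlonglongrightarrow> (\<integral>w. f' x0 w \<partial>M)"
    if X: "\<And>i. X i \<in> ?I - {x0}" "X \<longlonglongrightarrow> x0" for X :: "nat \<Rightarrow> real"
  proof -
    have m: "f' x0 \<in> borel_measurable M"
      by (rule borel_measurable_LIMSEQ_real[OF lim[OF X]]) (use Qm X in auto)
    have Qm': "?Q (X i) \<in> borel_measurable M" for i using Qm X by auto
    have ae1: "AE w in M. (\<lambda>i. ?Q (X i) w) \<longlonglongrightarrow> f' x0 w" using lim[OF X] by auto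
    have ae2: "AE w in M. norm (?Q (X i) w) \<le> g w" for i
      unfolding real_norm_def by (rule AE_I2, rule Qb[OF X(1)])
    show ?thesis
      using integrable_dominated_convergence[OF m Qm' g ae1 ae2]
        integral_dominated_convergence[OF m Qm' g ae1 ae2] by blast
  qed
  \<comment> \<open>Some sequence of difference quotients is needed to see that \<open>f' x0\<close> is integrable at all;
     the offset \<open>2\<close> keeps this one strictly below \<open>hi\<close>.\<close>
  have "(\<lambda>i. x0 + (hi - x0) / (real i + 2)) \<longlonglongrightarrow> x0 + 0"
    by (intro tendsto_add tendsto_const) real_asymp
  moreover have "x0 + (hi - x0) / (real i + 2) \<in> ?I - {x0}" for i
  proof -
    have "(hi - x0) * 1 < (hi - x0) * (real i + 2)"
      using x0 by (intro mult_strict_left_mono) auto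
    then have "(hi - x0) / (real i + 2) < hi - x0"
      by (simp add: divide_less_eq)
    moreover have "(hi - x0) / (real i + 2) > 0" using x0 by auto
    ultimately show ?thesis using x0 by auto
  qed
  ultimately show "integrable M (f' x0)"
    using main[of "\<lambda>i. x0 + (hi - x0) / (real i + 2)"] by simp
  have "((\<lambda>x. ((\<integral>w. f x w \<partial>M) - (\<integral>w. f x0 w \<partial>M)) / (x - x0)) \<longlongrightarrow> (\<integral>w. f' x0 w \<partial>M)) (at x0 within ?I)"
    unfolding tendsto_at_iff_sequentially
  proof (intro allI impI)
    fix X :: "nat \<Rightarrow> real" assume X: "\<forall>i. X i \<in> ?I - {x0}" "X \<longlonglongrightarrow> x0"
    have "((\<integral>w. f (X i) w \<partial>M) - (\<integral>w. f x0 w \<partial>M)) / (X i - x0) = (\<integral>w. ?Q (X i) w \<partial>M)" for i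
      using int[of "X i"] int[OF x0] X by simp
    then show "((\<lambda>x. ((\<integral>w. f x w \<partial>M) - (\<integral>w. f x0 w \<partial>M)) / (x - x0)) \<circ> X) \<longlonglongrightarrow> (\<integral>w. f' x0 w \<partial>M)"
      using main[of X] X by (simp add: comp_def)
  qed
  then show "((\<lambda>x. \<integral>w. f x w \<partial>M) has_real_derivative (\<integral>w. f' x0 w \<partial>M)) (at x0)"
    using at_within_open[OF x0] by (simp add: has_field_derivative_iff)
qed

lemma hyp01_ln_deriv:
  assumes a: "a > 0" and z: "z \<ge> 0"
  shows "((\<lambda>z. ln (hyp01 a z)) has_real_derivative hyp01 (a + 1) z / (a * hyp01 a z)) (at z)"
  using a hyp01_pos[OF a z] by (auto intro!: derivative_eq_intros simp: field_simps)

lemma ln_hyp01_nonneg: "a > 0 \<Longrightarrow> z \<ge> 0 \<Longrightarrow> ln (hyp01 a z) \<ge> 0"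
  using hyp01_ge_1[of a z] by simp

lemma ln_hyp01_mono: "a > 0 \<Longrightarrow> 0 \<le> x \<Longrightarrow> x \<le> y \<Longrightarrow> ln (hyp01 a x) \<le> ln (hyp01 a y)"
  using hyp01_mono[of a x y] hyp01_pos[of a x] by simp

lemma ln_hyp01_le_linear:
  assumes a: "a > 0" and z: "z \<ge> 0"
  shows "ln (hyp01 a z) \<le> z / a"
proof -
  have "ln (hyp01 a z) - z / a \<le> ln (hyp01 a 0) - 0 / a"
  proof (rule DERIV_nonpos_imp_nonincreasing[OF z, of "\<lambda>z. ln (hyp01 a z) - z / a"])
    fix x assume x: "0 \<le> x" "x \<le> z"
    let ?D = "hyp01 (a + 1) x / (a * hyp01 a x) - 1 / a"
    have "((\<lambda>z. ln (hyp01 a z) - z / a) has_real_derivative ?D) (at x)"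
      using a by (intro DERIV_diff hyp01_ln_deriv[OF a x(1)]) (auto intro!: derivative_eq_intros)
    moreover have "hyp01 (a + 1) x / (a * hyp01 a x) \<le> 1 / a"
      using hyp01_antimono_param[of a "a + 1" x] hyp01_pos[OF a x(1)] a x by (simp add: field_simps)
    ultimately show "\<exists>D. ((\<lambda>z. ln (hyp01 a z) - z / a) has_real_derivative D) (at x) \<and> D \<le> 0"
      by (intro exI[of _ ?D]) auto
  qed
  then show ?thesis by simp
qed

text \<open>
Integrates \<open>hyp01_log_deriv_bound\<close> in the form \<open>(ln f)' \<le> 1 / \<surd>z\<close>.  It gives the decay at infinity
that the integration by parts below needs; for large \<open>b\<close> the bound \<open>ln_hyp01_le_linear\<close> is too weak.
\<close>
lemma ln_hyp01_le_sqrt: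
  assumes a: "a \<ge> 1/2" and z: "z \<ge> 0"
  shows "ln (hyp01 a z) \<le> 2 * sqrt z"
proof -
  have a0: "a > 0" using a by simp
  show ?thesis
  proof (cases "z = 0")
    case False
    let ?f = "\<lambda>z. ln (hyp01 a z) - 2 * sqrt z"
    have "?f z \<le> ?f 0"
    proof (rule DERIV_nonpos_imp_decreasing_open[OF z, of ?f])
      show "continuous_on {0..z} ?f"
        using hyp01_pos[OF a0] a0 by (auto intro!: continuous_intros hyp01_continuous_on simp: less_imp_neq[symmetric])
      fix x assume x: "0 < x" "x < z"
      let ?q = "hyp01 (a + 1) x / (a * hyp01 a x)"
      have "(?f has_real_derivative ?q - 1 / sqrt x) (at x)"
        using x by (intro DERIV_diff hyp01_ln_deriv[OF a0]) (auto intro!: derivative_eq_intros simp: field_simps)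
      moreover have "?q \<le> 1 / sqrt x"
      proof -
        have p: "hyp01 a x > 0" "hyp01 (a + 1) x > 0" using hyp01_pos a0 x by auto
        have "(sqrt x * (hyp01 (a + 1) x / a))\<^sup>2 \<le> (hyp01 a x)\<^sup>2"
          using hyp01_log_deriv_bound[OF a, of x] x by (simp only: power_mult_distrib) simp
        then have "sqrt x * (hyp01 (a + 1) x / a) \<le> hyp01 a x"
          by (rule power2_le_imp_le) (use p in simp)
        then show ?thesis using p x a0 by (simp add: field_simps)
      qed
      ultimately show "\<exists>D. (?f has_real_derivative D) (at x) \<and> D \<le> 0"
        by (intro exI[of _ "?q - 1 / sqrt x"]) auto
    qed
    then show ?thesis by simp
  qed simp
qed

lemma has_integral_gamma_density_hyp01:
  assumes a: "a > 0" and b: "b \<ge> 0"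
  shows "has_bochner_integral lborel (\<lambda>u. gamma_density a 1 u * hyp01 a (b * u)) (exp b)"
  using nn_integral_gamma_density_hyp01[OF a b] gamma_density_hyp01_nonneg[OF a b]
  by (intro has_bochner_integral_nn_integral) auto

text \<open>
Multiplication by \<open>u\<close> stays within the family, so the first moment, and with it every function of
linear growth, is integrable against the noncentral density.
\<close>
lemma gamma_density_hyp01_shift:
  assumes a: "a > 0"
  shows "u * (gamma_density a 1 u * hyp01 a (b * u)) =
    a * (gamma_density (a + 1) 1 u * hyp01 (a + 1) (b * u)) +
    b * (gamma_density (a + 2) 1 u * hyp01 (a + 2) (b * u))"
proof -
  have 1: "u * gamma_density a 1 u = a * gamma_density (a + 1) 1 u"
    by (rule times_gamma_density[OF a])
  have 2: "u * gamma_density (a + 1) 1 u = (a + 1) * gamma_density (a + 2) 1 u"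
    using times_gamma_density[of "a + 1" u] a by (simp add: add.assoc)
  have "u * (gamma_density a 1 u * hyp01 a (b * u)) = (u * gamma_density a 1 u) * hyp01 (a + 1) (b * u) +
      b / (a * (a + 1)) * (u * (u * gamma_density a 1 u)) * hyp01 (a + 2) (b * u)"
    using hyp01_contiguous[OF a, of "b * u"] by (simp add: algebra_simps)
  also have "u * (u * gamma_density a 1 u) = a * (a + 1) * gamma_density (a + 2) 1 u"
    unfolding 1 using 2 by (simp add: mult.left_commute mult.assoc)
  also have "u * gamma_density a 1 u = a * gamma_density (a + 1) 1 u" by (rule 1)
  also have "b / (a * (a + 1)) * (a * (a + 1) * gamma_density (a + 2) 1 u) = b * gamma_density (a + 2) 1 u"
    using a by simp
  finally show ?thesis by (simp add: mult.assoc)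
qed

lemma has_integral_times_gamma_density_hyp01:
  assumes a: "a > 0" and b: "b \<ge> 0"
  shows "has_bochner_integral lborel (\<lambda>u. u * (gamma_density a 1 u * hyp01 a (b * u))) ((a + b) * exp b)"
proof -
  have "has_bochner_integral lborel
     (\<lambda>u. a * (gamma_density (a + 1) 1 u * hyp01 (a + 1) (b * u)) +
          b * (gamma_density (a + 2) 1 u * hyp01 (a + 2) (b * u))) (a * exp b + b * exp b)"
    using a b by (intro has_bochner_integral_add has_bochner_integral_mult_right
        has_integral_gamma_density_hyp01) auto
  then show ?thesis
    unfolding gamma_density_hyp01_shift[OF a] by (simp add: distrib_right)
qed

lemma integrable_gamma_density_hyp01_ln:
  assumes a: "a > 0" and c: "c > 0" and b: "b \<ge> 0"
  shows "integrable lborel (\<lambda>u. gamma_density c 1 u * hyp01 c (b * u) * ln (hyp01 a (b * u)))"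
proof (rule Bochner_Integration.integrable_bound)
  show "integrable lborel (\<lambda>u. b / a * (u * (gamma_density c 1 u * hyp01 c (b * u))))"
    using has_integral_times_gamma_density_hyp01[OF c b] by (auto simp: has_bochner_integral_iff)
  show "AE u in lborel. norm (gamma_density c 1 u * hyp01 c (b * u) * ln (hyp01 a (b * u)))
      \<le> norm (b / a * (u * (gamma_density c 1 u * hyp01 c (b * u))))"
  proof (intro AE_I2)
    fix u :: real
    let ?k = "gamma_density c 1 u * hyp01 c (b * u)"
    show "norm (?k * ln (hyp01 a (b * u))) \<le> norm (b / a * (u * ?k))"
    proof (cases "u > 0")
      case True
      have k: "?k \<ge> 0" using c b by (rule gamma_density_hyp01_nonneg)
      have "?k * ln (hyp01 a (b * u)) \<le> ?k * (b * u / a)"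
        using k a b True by (intro mult_left_mono ln_hyp01_le_linear) auto
      moreover have "?k * ln (hyp01 a (b * u)) \<ge> 0"
        using k ln_hyp01_nonneg[OF a, of "b * u"] b True by simp
      ultimately have "\<bar>?k * ln (hyp01 a (b * u))\<bar> \<le> b / a * (u * ?k)"
        by (simp add: mult_ac)
      then show ?thesis unfolding real_norm_def by linarith
    qed simp
  qed
qed measurable

text \<open>
With \<open>U\<close> of the noncentral gamma law with parameter \<open>b\<close>, this is the expectation of
\<open>ln (hyp01 a (b U))\<close>, the only part of the log-likelihood ratio that is not affine.
\<close>
definition mean_ln_hyp01 :: "real \<Rightarrow> real \<Rightarrow> real" where
  "mean_ln_hyp01 a b =
     exp (- b) * (\<integral>u. gamma_density a 1 u * hyp01 a (b * u) * ln (hyp01 a (b * u)) \<partial>lborel)"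

lemma mean_ln_hyp01_measurable [measurable]: "mean_ln_hyp01 a \<in> borel_measurable borel"
  unfolding mean_ln_hyp01_def[abs_def] by measurable

lemma mean_ln_hyp01_nonneg:
  assumes a: "a > 0" and b: "b \<ge> 0"
  shows "mean_ln_hyp01 a b \<ge> 0"
proof -
  have "gamma_density a 1 u * hyp01 a (b * u) * ln (hyp01 a (b * u)) \<ge> 0" for u
    using gamma_density_hyp01_nonneg[OF a b, of u] ln_hyp01_nonneg[OF a, of "b * u"] b
    by (cases "u > 0") auto
  then show ?thesis by (simp add: mean_ln_hyp01_def)
qed

lemma mean_ln_hyp01_le_quadratic:
  assumes a: "a > 0" and b: "b \<ge> 0"
  shows "mean_ln_hyp01 a b \<le> b * (a + b) / a"
proof -
  have "(\<integral>u. gamma_density a 1 u * hyp01 a (b * u) * ln (hyp01 a (b * u)) \<partial>lborel)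
      \<le> (\<integral>u. b / a * (u * (gamma_density a 1 u * hyp01 a (b * u))) \<partial>lborel)"
  proof (rule integral_mono)
    fix u :: real
    show "gamma_density a 1 u * hyp01 a (b * u) * ln (hyp01 a (b * u)) \<le>
        b / a * (u * (gamma_density a 1 u * hyp01 a (b * u)))"
    proof (cases "u > 0")
      case True
      have "gamma_density a 1 u * hyp01 a (b * u) * ln (hyp01 a (b * u)) \<le>
          gamma_density a 1 u * hyp01 a (b * u) * (b * u / a)"
        using a b True by (intro mult_left_mono ln_hyp01_le_linear gamma_density_hyp01_nonneg) auto
      then show ?thesis by (simp add: mult_ac)
    qed simp
  qed (use has_integral_times_gamma_density_hyp01[OF a b] in
      \<open>auto intro!: integrable_gamma_density_hyp01_ln a b simp: has_bochner_integral_iff\<close>)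
  also have "\<dots> = b / a * ((a + b) * exp b)"
    using has_integral_times_gamma_density_hyp01[OF a b]
    by (simp add: has_bochner_integral_iff)
  finally have "exp (- b) * (\<integral>u. gamma_density a 1 u * hyp01 a (b * u) * ln (hyp01 a (b * u)) \<partial>lborel)
      \<le> exp (- b) * (b / a * ((a + b) * exp b))"
    by (intro mult_left_mono) auto
  also have "\<dots> = (exp (- b) * exp b) * (b * (a + b) / a)" by simp
  also have "\<dots> = b * (a + b) / a" by (simp add: mult_exp_exp)
  finally show ?thesis by (simp add: mean_ln_hyp01_def)
qed

text \<open>
Differentiating \<open>f ln f\<close> with \<open>f = hyp01 a\<close> gives \<open>f' (ln f + 1)\<close>, and the factor \<open>u f'(b u)\<close>
raises the shape parameter from \<open>a\<close> to \<open>a + 1\<close>.  The summand \<open>f'\<close> integrates to \<open>exp b\<close>.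
\<close>
lemma deriv_unnormalised_mean_ln:
  assumes a: "a > 0" and b: "b > 0"
  shows "((\<lambda>b. \<integral>u. gamma_density a 1 u * hyp01 a (b * u) * ln (hyp01 a (b * u)) \<partial>lborel)
    has_real_derivative
    (\<integral>u. gamma_density (a + 1) 1 u * hyp01 (a + 1) (b * u) * ln (hyp01 a (b * u)) \<partial>lborel) + exp b) (at b)"
proof -
  let ?B = "\<lambda>b u. gamma_density (a + 1) 1 u * hyp01 (a + 1) (b * u) * ln (hyp01 a (b * u)) +
     gamma_density (a + 1) 1 u * hyp01 (a + 1) (b * u)"
  have int1: "integrable lborel (\<lambda>u. gamma_density (a + 1) 1 u * hyp01 (a + 1) (b * u) * ln (hyp01 a (b * u)))"
    if "b \<ge> 0" for b using a that by (intro integrable_gamma_density_hyp01_ln) auto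
  have int2: "has_bochner_integral lborel (\<lambda>u. gamma_density (a + 1) 1 u * hyp01 (a + 1) (b * u)) (exp b)"
    if "b \<ge> 0" for b using a that by (intro has_integral_gamma_density_hyp01) auto
  have "((\<lambda>b. \<integral>u. gamma_density a 1 u * hyp01 a (b * u) * ln (hyp01 a (b * u)) \<partial>lborel)
    has_real_derivative (\<integral>u. ?B b u \<partial>lborel)) (at b)"
  proof (rule has_real_derivative_integral(2)[where lo = 0 and hi = "2 * b" and g = "?B (2 * b)"])
    show "b \<in> {0<..<2 * b}" using b by auto
    show "integrable lborel (\<lambda>u. gamma_density a 1 u * hyp01 a (x * u) * ln (hyp01 a (x * u)))"
      if "x \<in> {0<..<2 * b}" for x
      using a that by (intro integrable_gamma_density_hyp01_ln) auto
    show "integrable lborel (?B (2 * b))"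
      using int1[of "2 * b"] int2[of "2 * b"] b by (auto simp: has_bochner_integral_iff)
    fix x u assume x: "x \<in> {0<..<2 * b}"
    show "((\<lambda>x. gamma_density a 1 u * hyp01 a (x * u) * ln (hyp01 a (x * u))) has_real_derivative ?B x u) (at x)"
    proof (cases "u > 0")
      case True
      have p: "hyp01 a (x * u) > 0" using a x True by (intro hyp01_pos) auto
      have g: "gamma_density (a + 1) 1 u = u * gamma_density a 1 u / a"
        using times_gamma_density[OF a, of u] a by simp
      show ?thesis
        unfolding g using a p by (auto intro!: derivative_eq_intros) (simp add: field_simps)
    qed simp
    show "\<bar>?B x u\<bar> \<le> ?B (2 * b) u"
    proof (cases "u > 0")
      case True
      have xu: "0 \<le> x * u" "x * u \<le> 2 * b * u" using x True by (auto intro!: mult_right_mono)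
      have h: "hyp01 (a + 1) (x * u) \<le> hyp01 (a + 1) (2 * b * u)" "hyp01 (a + 1) (x * u) > 0"
        using hyp01_mono[of "a + 1" "x * u"] hyp01_pos[of "a + 1" "x * u"] a xu by auto
      have L: "ln (hyp01 a (x * u)) \<le> ln (hyp01 a (2 * b * u))" "ln (hyp01 a (x * u)) \<ge> 0"
        using ln_hyp01_mono[OF a, of "x * u"] ln_hyp01_nonneg[OF a, of "x * u"] xu by auto
      have g: "gamma_density (a + 1) 1 u \<ge> 0" using a by (simp add: gamma_density_nonneg)
      have "?B x u \<le> ?B (2 * b) u"
        using h L g by (intro add_mono mult_mono) auto
      moreover have "?B x u \<ge> 0" using h L g by simp
      ultimately show ?thesis by simp
    qed simp
  qed
  also have "(\<integral>u. ?B b u \<partial>lborel) =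
    (\<integral>u. gamma_density (a + 1) 1 u * hyp01 (a + 1) (b * u) * ln (hyp01 a (b * u)) \<partial>lborel) + exp b"
    using int1[of b] int2[of b] b by (simp add: has_bochner_integral_iff)
  finally show ?thesis .
qed

lemma gamma_density_deriv:
  assumes a: "a > 0" and u: "u > 0"
  shows "(gamma_density (a + 1) 1 has_real_derivative gamma_density a 1 u - gamma_density (a + 1) 1 u) (at u)"
proof -
  have G: "Gamma (a + 1) = a * Gamma a" "Gamma a > 0"
    using Gamma_plus1[OF pos_real_not_nonpos_Int[OF a]] Gamma_real_pos[OF a] by auto
  have "((\<lambda>u. 1 / Gamma (a + 1) * (u powr a * exp (- u))) has_real_derivative
      1 / Gamma (a + 1) * (a * u powr (a - 1) * exp (- u) - u powr a * exp (- u))) (at u)"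
    using u by (intro DERIV_cmult) (auto intro!: derivative_eq_intros)
  also have "1 / Gamma (a + 1) * (a * u powr (a - 1) * exp (- u) - u powr a * exp (- u)) =
      gamma_density a 1 u - gamma_density (a + 1) 1 u"
    using u a G by (simp add: gamma_density_def divide_simps)
  finally have "((\<lambda>u. 1 / Gamma (a + 1) * (u powr a * exp (- u))) has_real_derivative
      gamma_density a 1 u - gamma_density (a + 1) 1 u) (at u)" .
  then show ?thesis
    by (rule has_field_derivative_transform_within_open[of _ _ _ "{0<..}"])
       (use u in \<open>auto simp: gamma_density_def\<close>)
qed

lemma gamma_density_isCont:
  assumes u: "u > 0"
  shows "isCont (gamma_density a 1) u"
proof -
  have "isCont (\<lambda>u. c * u powr (a - 1) * exp (- u)) u" for c
    using u by (auto intro!: continuous_intros)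
  then have "isCont (\<lambda>u. 1 / Gamma a * u powr (a - 1) * exp (- u)) u" .
  moreover have "\<forall>\<^sub>F x in nhds u. gamma_density a 1 x = 1 / Gamma a * x powr (a - 1) * exp (- x)"
    using u eventually_nhds_in_open[of "{0<..}" u] by (auto elim!: eventually_mono simp: gamma_density_def)
  ultimately show ?thesis
    by (subst isCont_cong) auto
qed

lemma integral_lborel_FTC_Ioi:
  fixes F f :: "real \<Rightarrow> real"
  assumes der: "\<And>u. u > 0 \<Longrightarrow> (F has_real_derivative f u) (at u)"
    and cont: "\<And>u. u > 0 \<Longrightarrow> isCont f u"
    and int: "integrable lborel f"
    and zero: "\<And>u. u \<le> 0 \<Longrightarrow> f u = 0"
    and lim0: "(F \<longlongrightarrow> A) (at_right 0)" and lim1: "(F \<longlongrightarrow> B) at_top"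
  shows "(\<integral>u. f u \<partial>lborel) = B - A"
proof -
  have I: "(\<lambda>u. indicator {0<..} u *\<^sub>R f u) = f"
    using zero by (auto simp: indicator_def not_less fun_eq_iff)
  have e: "einterval 0 \<infinity> = {0<..}"
    by (auto simp: einterval_def)
  have "(LBINT u=0..\<infinity>. f u) = B - A"
  proof (rule interval_integral_FTC_integrable)
    show "set_integrable lborel (einterval 0 \<infinity>) f"
      unfolding set_integrable_def e I by (rule int)
    show "((F \<circ> real_of_ereal) \<longlongrightarrow> A) (at_right 0)"
      using lim0 by (simp add: zero_ereal_def ereal_tendsto_simps)
    show "((F \<circ> real_of_ereal) \<longlongrightarrow> B) (at_left \<infinity>)"
      using lim1 by (simp add: ereal_tendsto_simps)
  qed (use der cont in \<open>auto simp: has_real_derivative_iff_has_vector_derivative[symmetric]\<close>)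
  then show ?thesis
    unfolding interval_lebesgue_integral_def set_lebesgue_integral_def e I by simp
qed

text \<open>
The boundary terms of the integration by parts below.
\<close>
lemma gamma_density_hyp01_ln_tendsto_0:
  assumes a: "a \<ge> 1/2" and b: "b > 0"
  defines "K \<equiv> \<lambda>u. gamma_density (a + 1) 1 u * hyp01 (a + 1) (b * u) * ln (hyp01 a (b * u))"
  shows "(K \<longlongrightarrow> 0) (at_right 0)" and "(K \<longlongrightarrow> 0) at_top"
proof -
  have a0: "a > 0" using a by simp
  let ?U = "\<lambda>u. 1 / Gamma (a + 1) * (u powr a * exp (- u) * exp (2 * sqrt (b * u)) * (2 * sqrt (b * u)))"
  have K: "0 \<le> K u" "K u \<le> ?U u" if u: "u > 0" for u
  proof -
    have bu: "b * u \<ge> 0" using b u by simp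
    have G: "Gamma (a + 1) > 0" using a by (intro Gamma_real_pos) auto
    have p: "hyp01 (a + 1) (b * u) > 0" using bu a by (intro hyp01_pos) auto
    have "ln (hyp01 (a + 1) (b * u)) \<le> 2 * sqrt (b * u)"
      using a bu by (intro ln_hyp01_le_sqrt) auto
    then have h: "hyp01 (a + 1) (b * u) \<le> exp (2 * sqrt (b * u))"
      using p by (metis exp_le_cancel_iff exp_ln)
    have L: "0 \<le> ln (hyp01 a (b * u))" "ln (hyp01 a (b * u)) \<le> 2 * sqrt (b * u)"
      using ln_hyp01_nonneg[OF a0 bu] ln_hyp01_le_sqrt[OF a bu] by auto
    have g: "gamma_density (a + 1) 1 u = 1 / Gamma (a + 1) * (u powr a * exp (- u))"
      using u by (simp add: gamma_density_def)
    have g0: "gamma_density (a + 1) 1 u \<ge> 0" using a by (simp add: gamma_density_nonneg)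
    show "0 \<le> K u" using g0 p L by (simp add: K_def)
    have "K u \<le> gamma_density (a + 1) 1 u * exp (2 * sqrt (b * u)) * (2 * sqrt (b * u))"
      unfolding K_def using g0 p L h bu by (intro mult_mono) auto
    then show "K u \<le> ?U u" unfolding g by (simp only: mult.assoc)
  qed
  show "(K \<longlongrightarrow> 0) (at_right 0)"
  proof (rule tendsto_sandwich[OF _ _ tendsto_const])
    show "\<forall>\<^sub>F u in at_right 0. 0 \<le> K u" "\<forall>\<^sub>F u in at_right 0. K u \<le> ?U u"
      using K by (auto intro!: eventually_mono[OF eventually_at_right_less[of 0]])
    have "((\<lambda>u. u powr a * exp (- u) * exp (2 * sqrt (b * u)) * (2 * sqrt (b * u))) \<longlongrightarrow> 0) (at_right 0)"
      using a0 b by real_asymp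
    from tendsto_mult_left[OF this, of "1 / Gamma (a + 1)"]
    show "(?U \<longlongrightarrow> 0) (at_right 0)" by simp
  qed
  show "(K \<longlongrightarrow> 0) at_top"
  proof (rule tendsto_sandwich[OF _ _ tendsto_const])
    show "\<forall>\<^sub>F u in at_top. 0 \<le> K u" "\<forall>\<^sub>F u in at_top. K u \<le> ?U u"
      using K by (auto intro!: eventually_mono[OF eventually_gt_at_top[of 0]])
    have "((\<lambda>u. u powr a * exp (- u) * exp (2 * sqrt (b * u)) * (2 * sqrt (b * u))) \<longlongrightarrow> 0) at_top"
      using a0 b by real_asymp
    from tendsto_mult_left[OF this, of "1 / Gamma (a + 1)"]
    show "(?U \<longlongrightarrow> 0) at_top" by simp
  qed
qed

text \<open>
Write \<open>A\<close>, \<open>B\<close> for the two integrands.  By the contiguity relation, \<open>B' = A - B + C\<close> with \<open>C\<close> equal to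
the unnormalised density \<open>gamma_density a 1 u * f z\<close> times \<open>z f'(z)\<^sup>2 / f(z)\<^sup>2\<close> at \<open>z = b u\<close>, \<open>f = hyp01 a\<close>.  Since \<open>B\<close> vanishes at both ends,
the difference of the integrals is the integral of \<open>C\<close>, and the key inequality bounds \<open>C\<close> by the
unnormalised density itself, whose total mass is \<open>exp b\<close>.
\<close>
lemma mean_ln_hyp01_parts:
  assumes a: "a \<ge> 1/2" and b: "b > 0"
  defines "A \<equiv> \<lambda>u. gamma_density a 1 u * hyp01 a (b * u) * ln (hyp01 a (b * u))"
    and "B \<equiv> \<lambda>u. gamma_density (a + 1) 1 u * hyp01 (a + 1) (b * u) * ln (hyp01 a (b * u))"
  shows "0 \<le> (\<integral>u. B u \<partial>lborel) - (\<integral>u. A u \<partial>lborel)"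
    and "(\<integral>u. B u \<partial>lborel) - (\<integral>u. A u \<partial>lborel) \<le> exp b"
proof -
  have a0: "a > 0" using a by simp
  let ?q = "\<lambda>u. hyp01 (a + 1) (b * u) / (a * hyp01 a (b * u))"
  define C where "C u = gamma_density (a + 1) 1 u * hyp01 (a + 1) (b * u) * (b * ?q u)" for u
  have [measurable]: "C \<in> borel_measurable borel" unfolding C_def[abs_def] by measurable
  have C: "0 \<le> C u" "C u \<le> gamma_density a 1 u * hyp01 a (b * u)" for u
  proof -
    have "0 \<le> C u \<and> C u \<le> gamma_density a 1 u * hyp01 a (b * u)"
    proof (cases "u > 0")
      case True
      let ?z = "b * u" and ?p = "hyp01 (a + 1) (b * u)" and ?h = "hyp01 a (b * u)"
      have z: "?z \<ge> 0" using b True by simp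
      have p: "?p > 0" "?h > 0" using hyp01_pos[OF _ z] a by auto
      have g: "gamma_density a 1 u \<ge> 0" using a0 by (rule gamma_density_nonneg)
      have g1: "gamma_density (a + 1) 1 u = u * gamma_density a 1 u / a"
        using times_gamma_density[OF a0, of u] a by simp
      have eq: "C u = gamma_density a 1 u * (?z * (?p / a)\<^sup>2 / ?h)"
        unfolding C_def g1 using a0 p by (simp add: power2_eq_square field_simps)
      have "?z * (?p / a)\<^sup>2 / ?h \<le> ?h"
        using hyp01_log_deriv_bound[OF a z] p by (subst pos_divide_le_eq) (auto simp: power2_eq_square)
      then have "C u \<le> gamma_density a 1 u * ?h"
        unfolding eq using g by (rule mult_left_mono)
      moreover have "0 \<le> C u"
        unfolding eq using g z p by simp
      ultimately show ?thesis by simp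
    qed (simp add: C_def)
    then show "0 \<le> C u" "C u \<le> gamma_density a 1 u * hyp01 a (b * u)" by auto
  qed
  have D: "has_bochner_integral lborel (\<lambda>u. gamma_density a 1 u * hyp01 a (b * u)) (exp b)"
    using a b by (intro has_integral_gamma_density_hyp01) auto
  have intC: "integrable lborel C"
  proof (rule Bochner_Integration.integrable_bound)
    show "integrable lborel (\<lambda>u. gamma_density a 1 u * hyp01 a (b * u))"
      using D by (simp add: has_bochner_integral_iff)
    show "AE u in lborel. norm (C u) \<le> norm (gamma_density a 1 u * hyp01 a (b * u))"
    proof (rule AE_I2)
      fix u show "norm (C u) \<le> norm (gamma_density a 1 u * hyp01 a (b * u))"
        using C[of u] unfolding real_norm_def by linarith
    qed
  qed measurable
  have intA: "integrable lborel A" and intB: "integrable lborel B"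
    unfolding A_def B_def using a b by (auto intro!: integrable_gamma_density_hyp01_ln)
  have "(\<integral>u. A u - B u + C u \<partial>lborel) = 0 - 0"
  proof (rule integral_lborel_FTC_Ioi[where F = B])
    show "integrable lborel (\<lambda>u. A u - B u + C u)"
      using intA intB intC by auto
    show "(B \<longlongrightarrow> 0) (at_right 0)" "(B \<longlongrightarrow> 0) at_top"
      unfolding B_def using gamma_density_hyp01_ln_tendsto_0[OF a b] by auto
    fix u :: real
    {
      assume "u \<le> 0"
      then show "A u - B u + C u = 0" by (simp add: A_def B_def C_def)
    }
    assume u: "u > 0"
    let ?L = "ln (hyp01 a (b * u))"
    have bu: "b * u \<ge> 0" using b u by simp
    have p: "hyp01 a (b * u) > 0" using hyp01_pos[OF a0 bu] .
    show "isCont (\<lambda>u. A u - B u + C u) u"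
      unfolding A_def B_def C_def using p a0 u
      by (intro continuous_intros gamma_density_isCont isCont_o2[OF _ hyp01_cont]) auto
    have d1: "((\<lambda>u. hyp01 (a + 1) (b * u)) has_real_derivative b * hyp01 (a + 2) (b * u) / (a + 1)) (at u)"
    proof -
      have e: "a + 1 + 1 = a + 2" by simp
      have "((\<lambda>u. hyp01 (a + 1) (b * u)) has_real_derivative hyp01 (a + 2) (b * u) / (a + 1) * b) (at u)"
        using a0 by (intro DERIV_chain2[OF hyp01_deriv[of "a + 1", unfolded e]])
          (auto intro!: derivative_eq_intros)
      then show ?thesis by (simp add: mult.commute)
    qed
    have d2: "((\<lambda>u. ln (hyp01 a (b * u))) has_real_derivative b * ?q u) (at u)"
    proof -
      have "((\<lambda>u. ln (hyp01 a (b * u))) has_real_derivative ?q u * b) (at u)"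
        by (rule DERIV_chain2[where f = "\<lambda>z. ln (hyp01 a z)" and g = "\<lambda>u. b * u" and x = u, OF hyp01_ln_deriv[OF a0 bu]])
           (auto intro!: derivative_eq_intros)
      then show ?thesis by (simp add: mult.commute)
    qed
    have "(B has_real_derivative
        ((gamma_density a 1 u - gamma_density (a + 1) 1 u) * hyp01 (a + 1) (b * u) +
          (b * hyp01 (a + 2) (b * u) / (a + 1)) * gamma_density (a + 1) 1 u) * ?L +
        (b * ?q u) * (gamma_density (a + 1) 1 u * hyp01 (a + 1) (b * u))) (at u)"
      unfolding B_def by (intro DERIV_mult gamma_density_deriv a0 u d1 d2)
    also have "((gamma_density a 1 u - gamma_density (a + 1) 1 u) * hyp01 (a + 1) (b * u) +
          (b * hyp01 (a + 2) (b * u) / (a + 1)) * gamma_density (a + 1) 1 u) * ?L +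
        (b * ?q u) * (gamma_density (a + 1) 1 u * hyp01 (a + 1) (b * u)) =
        (gamma_density a 1 u * hyp01 (a + 1) (b * u) +
          (b * hyp01 (a + 2) (b * u) / (a + 1)) * gamma_density (a + 1) 1 u) * ?L - B u + C u"
      by (simp add: B_def C_def algebra_simps)
    also have "gamma_density a 1 u * hyp01 (a + 1) (b * u) +
        (b * hyp01 (a + 2) (b * u) / (a + 1)) * gamma_density (a + 1) 1 u = gamma_density a 1 u * hyp01 a (b * u)"
    proof -
      have "gamma_density (a + 1) 1 u = u * gamma_density a 1 u / a"
        using times_gamma_density[OF a0, of u] a by simp
      then show ?thesis
        using a0 by (subst hyp01_contiguous[OF a0, of "b * u"]) (simp add: algebra_simps)
    qed
    finally show "(B has_real_derivative A u - B u + C u) (at u)"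
      unfolding A_def .
  qed
  then have eq: "(\<integral>u. B u \<partial>lborel) - (\<integral>u. A u \<partial>lborel) = (\<integral>u. C u \<partial>lborel)"
    using intA intB intC by simp
  show "0 \<le> (\<integral>u. B u \<partial>lborel) - (\<integral>u. A u \<partial>lborel)"
    unfolding eq using C by simp
  have "(\<integral>u. C u \<partial>lborel) \<le> (\<integral>u. gamma_density a 1 u * hyp01 a (b * u) \<partial>lborel)"
    using intC D C by (intro integral_mono) (auto simp: has_bochner_integral_iff)
  also have "\<dots> = exp b" using D by (simp add: has_bochner_integral_iff)
  finally show "(\<integral>u. B u \<partial>lborel) - (\<integral>u. A u \<partial>lborel) \<le> exp b"
    unfolding eq .
qed

lemma mean_ln_hyp01_deriv:
  assumes a: "a \<ge> 1/2" and b: "b > 0"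
  obtains D where "(mean_ln_hyp01 a has_real_derivative D) (at b)" "0 \<le> D" "D \<le> 2"
proof -
  let ?A = "\<integral>u. gamma_density a 1 u * hyp01 a (b * u) * ln (hyp01 a (b * u)) \<partial>lborel"
  let ?B = "\<integral>u. gamma_density (a + 1) 1 u * hyp01 (a + 1) (b * u) * ln (hyp01 a (b * u)) \<partial>lborel"
  have a0: "a > 0" using a by simp
  let ?D = "(?B - ?A) * exp (- b) + 1"
  have "((\<lambda>b. exp (- b)) has_real_derivative - exp (- b)) (at b)"
    by (auto intro!: derivative_eq_intros)
  from DERIV_mult[OF this deriv_unnormalised_mean_ln[OF a0 b]]
  have "(mean_ln_hyp01 a has_real_derivative - exp (- b) * ?A + (?B + exp b) * exp (- b)) (at b)"
    by (simp add: mean_ln_hyp01_def[abs_def])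
  also have "- exp (- b) * ?A + (?B + exp b) * exp (- b) = ?D"
    by (simp add: distrib_right mult_exp_exp algebra_simps)
  finally have "(mean_ln_hyp01 a has_real_derivative ?D) (at b)" .
  moreover have "0 \<le> ?D"
    using mean_ln_hyp01_parts(1)[OF a b] by (intro add_nonneg_nonneg mult_nonneg_nonneg) auto
  moreover have "?D \<le> 2"
  proof -
    have "(?B - ?A) * exp (- b) \<le> exp b * exp (- b)"
      using mean_ln_hyp01_parts(2)[OF a b] by (intro mult_right_mono) auto
    then show ?thesis by (simp add: mult_exp_exp)
  qed
  ultimately show ?thesis by (rule that)
qed

text \<open>
The slope is at most \<open>2\<close> on \<open>b > 0\<close>; the quadratic bound supplies the value \<open>0\<close> at the boundary.
\<close>
lemma mean_ln_hyp01_le_linear: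
  assumes a: "a \<ge> 1/2" and b: "b \<ge> 0"
  shows "mean_ln_hyp01 a b \<le> 2 * b"
proof (cases "b = 0")
  case True
  then show ?thesis using mean_ln_hyp01_le_quadratic[of a 0] a by simp
next
  case False
  then have b: "b > 0" using b by simp
  have a0: "a > 0" using a by simp
  have "mean_ln_hyp01 a b - 2 * b \<le> c * (a + c) / a - 2 * c" if c: "c \<in> {0<..<b}" for c
  proof -
    have "mean_ln_hyp01 a b - 2 * b \<le> mean_ln_hyp01 a c - 2 * c"
    proof (rule DERIV_nonpos_imp_nonincreasing[of c b "\<lambda>b. mean_ln_hyp01 a b - 2 * b"])
      fix x assume "c \<le> x" "x \<le> b"
      then have "x > 0" using c by auto
      from mean_ln_hyp01_deriv[OF a this] obtain D where
        D: "(mean_ln_hyp01 a has_real_derivative D) (at x)" "D \<le> 2" by metis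
      then have "((\<lambda>b. mean_ln_hyp01 a b - 2 * b) has_real_derivative D - 2) (at x)"
        by (auto intro!: derivative_eq_intros)
      then show "\<exists>y. ((\<lambda>b. mean_ln_hyp01 a b - 2 * b) has_real_derivative y) (at x) \<and> y \<le> 0"
        using D by (intro exI[of _ "D - 2"]) auto
    qed (use c in auto)
    then show ?thesis using mean_ln_hyp01_le_quadratic[OF a0, of c] c by auto
  qed
  then have "\<forall>\<^sub>F c in at_right 0. mean_ln_hyp01 a b - 2 * b \<le> c * (a + c) / a - 2 * c"
    using eventually_at_right_real[OF b] by (auto elim: eventually_mono)
  moreover have "((\<lambda>c. c * (a + c) / a - 2 * c) \<longlongrightarrow> 0 * (a + 0) / a - 2 * 0) (at_right 0)"
    using a0 by (intro tendsto_intros) auto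
  ultimately have "mean_ln_hyp01 a b - 2 * b \<le> 0 * (a + 0) / a - 2 * 0"
    by (intro tendsto_lowerbound[of _ _ "at_right (0::real)"]) auto
  then show ?thesis by simp
qed

text \<open>
The expectation of \<open>mean_ln_hyp01 a (s V)\<close> for an input \<open>V\<close> of law \<open>gamma_law a 1\<close>.
\<close>
definition gamma_mean_ln_hyp01 :: "real \<Rightarrow> real \<Rightarrow> real" where
  "gamma_mean_ln_hyp01 a s = (\<integral>v. gamma_density a 1 v * mean_ln_hyp01 a (s * v) \<partial>lborel)"

lemma gamma_density_mean:
  assumes a: "a > 0"
  shows "has_bochner_integral lborel (\<lambda>v. v * gamma_density a 1 v) a"
proof -
  have "has_bochner_integral lborel (\<lambda>v. a * gamma_density (a + 1) 1 v) (a * 1)"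
    using a nn_integral_gamma_density_1[of "a + 1"]
    by (intro has_bochner_integral_mult_right has_bochner_integral_nn_integral) (auto simp: gamma_density_nonneg)
  then show ?thesis by (simp add: times_gamma_density[OF a])
qed

lemma integrable_gamma_mean_ln:
  assumes a: "a \<ge> 1/2" and s: "s \<ge> 0"
  shows "integrable lborel (\<lambda>v. gamma_density a 1 v * mean_ln_hyp01 a (s * v))"
    and "gamma_mean_ln_hyp01 a s \<le> 2 * s * a"
    and "\<And>v. gamma_density a 1 v * mean_ln_hyp01 a (s * v) \<ge> 0"
proof -
  have a0: "a > 0" using a by simp
  have b: "0 \<le> gamma_density a 1 v * mean_ln_hyp01 a (s * v) \<and>
      gamma_density a 1 v * mean_ln_hyp01 a (s * v) \<le> 2 * s * (v * gamma_density a 1 v)" for v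
  proof (cases "v > 0")
    case True
    have "gamma_density a 1 v * mean_ln_hyp01 a (s * v) \<le> gamma_density a 1 v * (2 * (s * v))"
      using s True by (intro mult_left_mono mean_ln_hyp01_le_linear a gamma_density_nonneg a0) auto
    moreover have "gamma_density a 1 v * mean_ln_hyp01 a (s * v) \<ge> 0"
      using s True by (intro mult_nonneg_nonneg mean_ln_hyp01_nonneg gamma_density_nonneg a0) auto
    ultimately show ?thesis by (simp add: mult_ac)
  qed simp
  then show "\<And>v. gamma_density a 1 v * mean_ln_hyp01 a (s * v) \<ge> 0" by blast
  have m: "has_bochner_integral lborel (\<lambda>v. 2 * s * (v * gamma_density a 1 v)) (2 * s * a)"
    by (intro has_bochner_integral_mult_right gamma_density_mean a0)
  show i: "integrable lborel (\<lambda>v. gamma_density a 1 v * mean_ln_hyp01 a (s * v))"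
  proof (rule Bochner_Integration.integrable_bound)
    show "integrable lborel (\<lambda>v. 2 * s * (v * gamma_density a 1 v))"
      using m by (simp add: has_bochner_integral_iff)
    show "AE v in lborel. norm (gamma_density a 1 v * mean_ln_hyp01 a (s * v))
        \<le> norm (2 * s * (v * gamma_density a 1 v))"
    proof (rule AE_I2)
      fix v show "norm (gamma_density a 1 v * mean_ln_hyp01 a (s * v)) \<le> norm (2 * s * (v * gamma_density a 1 v))"
        using b[of v] unfolding real_norm_def by linarith
    qed
  qed measurable
  show "gamma_mean_ln_hyp01 a s \<le> 2 * s * a"
    unfolding gamma_mean_ln_hyp01_def using i m b
    by (subst has_bochner_integral_integral_eq[OF m, symmetric])
       (intro integral_mono, auto simp: has_bochner_integral_iff)
qed

text \<open>
The derivative is the expectation of \<open>V h'(s V)\<close> with \<open>h = mean_ln_hyp01 a\<close>.  As \<open>0 \<le> h' \<le> 2\<close>, the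
variable \<open>2 V\<close> both dominates the differentiation and bounds the result by \<open>2 a\<close>.
\<close>
lemma gamma_mean_ln_hyp01_deriv:
  assumes a: "a \<ge> 1/2" and s: "s > 0"
  obtains D where "(gamma_mean_ln_hyp01 a has_real_derivative D) (at s)" "D \<le> 2 * a"
proof -
  have a0: "a > 0" using a by simp
  let ?h = "mean_ln_hyp01 a"
  have d: "(?h has_real_derivative deriv ?h b) (at b)" "0 \<le> deriv ?h b" "deriv ?h b \<le> 2" if b: "b > 0" for b
  proof -
    obtain D where D: "(?h has_real_derivative D) (at b)" "0 \<le> D" "D \<le> 2"
      using mean_ln_hyp01_deriv[OF a b] .
    then have "deriv ?h b = D" by (intro DERIV_imp_deriv)
    then show "(?h has_real_derivative deriv ?h b) (at b)" "0 \<le> deriv ?h b" "deriv ?h b \<le> 2"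
      using D by auto
  qed
  let ?f' = "\<lambda>s v. gamma_density a 1 v * (deriv ?h (s * v) * v)"
  have m: "has_bochner_integral lborel (\<lambda>v. 2 * (v * gamma_density a 1 v)) (2 * a)"
    by (intro has_bochner_integral_mult_right gamma_density_mean a0)
  have bnd: "0 \<le> ?f' x v \<and> ?f' x v \<le> 2 * (v * gamma_density a 1 v)" if "x > 0" for x v
  proof (cases "v > 0")
    case True
    have "gamma_density a 1 v * (deriv ?h (x * v) * v) \<le> gamma_density a 1 v * (2 * v)"
      using True that d[of "x * v"] by (intro mult_left_mono mult_right_mono gamma_density_nonneg a0) auto
    moreover have "gamma_density a 1 v * (deriv ?h (x * v) * v) \<ge> 0"
      using True that d[of "x * v"] gamma_density_nonneg[OF a0, of 1 v] by auto
    ultimately show ?thesis by (simp add: mult_ac)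
  qed simp
  have s_in: "s \<in> {0<..<2 * s}" using s by auto
  have int: "integrable lborel (\<lambda>v. gamma_density a 1 v * ?h (x * v))" if "x \<in> {0<..<2 * s}" for x
    using integrable_gamma_mean_ln(1)[OF a] that by auto
  have der: "((\<lambda>x. gamma_density a 1 v * ?h (x * v)) has_real_derivative ?f' x v) (at x)"
    if "x \<in> {0<..<2 * s}" for x v
  proof (cases "v > 0")
    case True
    then have "((\<lambda>x. ?h (x * v)) has_real_derivative deriv ?h (x * v) * v) (at x)"
      using d(1)[of "x * v"] that by (intro DERIV_chain2[of ?h]) (auto intro!: derivative_eq_intros)
    then show ?thesis by (rule DERIV_cmult)
  qed simp
  have abs_bnd: "\<bar>?f' x v\<bar> \<le> 2 * (v * gamma_density a 1 v)" if "x \<in> {0<..<2 * s}" for x v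
    using bnd[of x v] that by auto
  have g: "integrable lborel (\<lambda>v. 2 * (v * gamma_density a 1 v))"
    using m by (simp add: has_bochner_integral_iff)
  note leibniz = has_real_derivative_integral[where M = lborel and f' = ?f', OF s_in int der abs_bnd g]
  have "(\<integral>v. ?f' s v \<partial>lborel) \<le> (\<integral>v. 2 * (v * gamma_density a 1 v) \<partial>lborel)"
    using leibniz(1) g bnd[OF s] by (intro integral_mono) auto
  then have "(\<integral>v. ?f' s v \<partial>lborel) \<le> 2 * a"
    unfolding has_bochner_integral_integral_eq[OF m] .
  with leibniz(2) show ?thesis
    by (intro that[of "\<integral>v. ?f' s v \<partial>lborel"]) (auto simp: gamma_mean_ln_hyp01_def[abs_def])
qed

section \<open>The mutual information in closed form and its bounds\<close>

context quadratic_gamma_channel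
begin

lemma expectation_ln_hyp01:
  "has_bochner_integral M (\<lambda>\<omega>. ln (hyp01 a (s * \<bar>\<nu> * X \<omega> * (l * Y \<omega>)\<bar>))) (gamma_mean_ln_hyp01 a s)"
proof (rule has_bochner_integral_nn_integral)
  have "(\<integral>\<^sup>+\<omega>. ennreal (ln (hyp01 a (s * \<bar>\<nu> * X \<omega> * (l * Y \<omega>)\<bar>))) \<partial>M) =
    (\<integral>\<^sup>+v. ennreal (gamma_density a 1 v) * (ennreal (exp (- (s * v))) *
        (\<integral>\<^sup>+u. ennreal (gamma_density a 1 u * hyp01 a (s * v * u)) * ennreal (ln (hyp01 a (s * \<bar>v * u\<bar>))) \<partial>lborel)) \<partial>lborel)"
    using nn_integral_joint[of "\<lambda>(v, u). ennreal (ln (hyp01 a (s * \<bar>v * u\<bar>)))"] by simp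
  also have "\<dots> = (\<integral>\<^sup>+v. ennreal (gamma_density a 1 v * mean_ln_hyp01 a (s * v)) \<partial>lborel)"
  proof (rule nn_integral_cong)
    fix v :: real
    show "ennreal (gamma_density a 1 v) * (ennreal (exp (- (s * v))) *
        (\<integral>\<^sup>+u. ennreal (gamma_density a 1 u * hyp01 a (s * v * u)) * ennreal (ln (hyp01 a (s * \<bar>v * u\<bar>))) \<partial>lborel)) =
        ennreal (gamma_density a 1 v * mean_ln_hyp01 a (s * v))"
    proof (cases "v > 0")
      case True
      let ?f = "\<lambda>u. gamma_density a 1 u * hyp01 a (s * v * u) * ln (hyp01 a (s * v * u))"
      have sv: "s * v \<ge> 0" using s_nonneg True by simp
      have f0: "?f u \<ge> 0" for u
        using gamma_density_hyp01_nonneg[OF a_pos sv, of u] ln_hyp01_nonneg[OF a_pos, of "s * v * u"] sv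
        by (cases "u > 0") auto
      have "(\<integral>\<^sup>+u. ennreal (gamma_density a 1 u * hyp01 a (s * v * u)) * ennreal (ln (hyp01 a (s * \<bar>v * u\<bar>))) \<partial>lborel)
          = (\<integral>\<^sup>+u. ennreal (?f u) \<partial>lborel)"
      proof (rule nn_integral_cong)
        fix u :: real
        show "ennreal (gamma_density a 1 u * hyp01 a (s * v * u)) * ennreal (ln (hyp01 a (s * \<bar>v * u\<bar>))) = ennreal (?f u)"
        proof (cases "u > 0")
          case u: True
          have e: "s * \<bar>v * u\<bar> = s * v * u" using u True by simp
          show ?thesis
            unfolding e
            using gamma_density_hyp01_nonneg[OF a_pos sv, of u] ln_hyp01_nonneg[OF a_pos, of "s * v * u"] sv u
            by (simp add: ennreal_mult)
        qed simp
      qed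
      also have "\<dots> = ennreal (\<integral>u. ?f u \<partial>lborel)"
        using f0 by (intro nn_integral_eq_integral integrable_gamma_density_hyp01_ln a_pos sv) auto
      finally show ?thesis
        using f0 a_pos by (simp add: mean_ln_hyp01_def ennreal_mult gamma_density_nonneg)
    qed simp
  qed
  also have "\<dots> = ennreal (gamma_mean_ln_hyp01 a s)"
    unfolding gamma_mean_ln_hyp01_def using integrable_gamma_mean_ln[OF a s_nonneg]
    by (intro nn_integral_eq_integral) auto
  finally show "(\<integral>\<^sup>+\<omega>. ennreal (ln (hyp01 a (s * \<bar>\<nu> * X \<omega> * (l * Y \<omega>)\<bar>))) \<partial>M) = ennreal (gamma_mean_ln_hyp01 a s)" .
  show "0 \<le> gamma_mean_ln_hyp01 a s"
    unfolding gamma_mean_ln_hyp01_def using integrable_gamma_mean_ln(3)[OF a s_nonneg] by simp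
  show "AE \<omega> in M. 0 \<le> ln (hyp01 a (s * \<bar>\<nu> * X \<omega> * (l * Y \<omega>)\<bar>))"
    using s_nonneg by (intro AE_I2 ln_hyp01_nonneg a_pos) auto
qed measurable

text \<open>
The affine part of the log-likelihood ratio contributes \<open>- s a\<close> twice: once through the input, of mean
\<open>a\<close>, and once through the output, of mean \<open>a (1 + s)\<close>.
\<close>
lemma mutual_info_formula:
  shows "mutual_info_finite M X Y"
    and "mutual_info M X Y = a * ln (1 + s) - 2 * s * a + gamma_mean_ln_hyp01 a s"
proof -
  have "has_bochner_integral M (\<lambda>\<omega>. a * ln (1 + s) - s * (\<nu> * X \<omega>) - s / (1 + s) * (l * Y \<omega>)
      + ln (hyp01 a (s * \<bar>\<nu> * X \<omega> * (l * Y \<omega>)\<bar>)))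
      (a * ln (1 + s) - s * a - s / (1 + s) * (a * (1 + s)) + gamma_mean_ln_hyp01 a s)"
    by (intro has_bochner_integral_add has_bochner_integral_diff has_bochner_integral_mult_right
        expectation_input expectation_output expectation_ln_hyp01)
       (simp add: has_bochner_integral_iff prob_space)
  then have "has_bochner_integral M (\<lambda>\<omega>. ln (channel_density_ratio a s (\<nu> * X \<omega>, l * Y \<omega>)))
      (a * ln (1 + s) - s * a - s / (1 + s) * (a * (1 + s)) + gamma_mean_ln_hyp01 a s)"
    by (simp only: ln_channel_density_ratio[OF a_pos s_nonneg])
  moreover have "s / (1 + s) * (a * (1 + s)) = s * a" using s_nonneg by simp
  ultimately show "mutual_info_finite M X Y"
    and "mutual_info M X Y = a * ln (1 + s) - 2 * s * a + gamma_mean_ln_hyp01 a s"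
    unfolding mutual_info_eq_expectation has_bochner_integral_iff by auto
qed

lemma mutual_info_bound: "mutual_info M X Y \<le> a * ln (1 + s)"
  using mutual_info_formula(2) integrable_gamma_mean_ln(2)[OF a s_nonneg] by simp

end

theorem mainTheorem4:
  fixes M :: "'a measure" and X G N :: "'a \<Rightarrow> real" and \<alpha> l :: real
  assumes "prob_space M"
    and "\<alpha> \<ge> 1/2" and "l > 0"
    and "prob_space.indep_vars M (\<lambda>_. borel) (\<lambda>i. [X, G, N] ! i) {..<3::nat}"
    and "distr M borel G = gamma_law (\<alpha> - 1/2) l"
    and "distributed M lborel N (\<lambda>x. ennreal (std_normal_density x))"
  shows
    "(distr M borel X = gamma_law \<alpha> l \<longrightarrow>
       (\<forall>r>0.
          mutual_info_finite M X (quadratic_gamma_output l G N X r) \<and>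
          (\<exists>D. ((\<lambda>s. mutual_info M X (quadratic_gamma_output l G N X s))
                  has_real_derivative D) (at r) \<and> D \<le> \<alpha> / (1 + r)) \<and>
          mutual_info M X (quadratic_gamma_output l G N X r) \<le> \<alpha> * ln (1 + r))) \<and>
     (\<forall>\<nu>>0. distr M borel X = gamma_law \<alpha> \<nu> \<longrightarrow>
       (\<forall>r>0.
          mutual_info_finite M X (quadratic_gamma_output l G N X r) \<and>
          mutual_info M X (quadratic_gamma_output l G N X r) \<le> \<alpha> * ln (1 + l * r / \<nu>)))"
proof -
  have channel: "quadratic_gamma_channel M X G N \<alpha> l \<nu> r"
    if "distr M borel X = gamma_law \<alpha> \<nu>" "\<nu> > 0" "r > 0" for \<nu> r
    using assms that by (simp add: quadratic_gamma_channel_def quadratic_gamma_channel_axioms_def)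
  have general: "mutual_info_finite M X (quadratic_gamma_output l G N X r) \<and>
      mutual_info M X (quadratic_gamma_output l G N X r) \<le> \<alpha> * ln (1 + l * r / \<nu>)"
    if "distr M borel X = gamma_law \<alpha> \<nu>" "\<nu> > 0" "r > 0" for \<nu> r
    using quadratic_gamma_channel.mutual_info_formula(1)[OF channel[OF that]]
      quadratic_gamma_channel.mutual_info_bound[OF channel[OF that]]
      quadratic_gamma_channel.s_def[OF channel[OF that]] by simp
  have deriv: "\<exists>D. ((\<lambda>s. mutual_info M X (quadratic_gamma_output l G N X s)) has_real_derivative D) (at r) \<and>
      D \<le> \<alpha> / (1 + r)"
    if X: "distr M borel X = gamma_law \<alpha> l" and r: "r > 0" for r
  proof -
    obtain D where D: "(gamma_mean_ln_hyp01 \<alpha> has_real_derivative D) (at r)" "D \<le> 2 * \<alpha>"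
      using gamma_mean_ln_hyp01_deriv[OF assms(2) r] .
    have "((\<lambda>s. \<alpha> * ln (1 + s) - 2 * s * \<alpha> + gamma_mean_ln_hyp01 \<alpha> s) has_real_derivative
        \<alpha> / (1 + r) - 2 * \<alpha> + D) (at r)"
      using r by (intro DERIV_add D(1)) (auto intro!: derivative_eq_intros)
    then have "((\<lambda>s. mutual_info M X (quadratic_gamma_output l G N X s)) has_real_derivative
        \<alpha> / (1 + r) - 2 * \<alpha> + D) (at r)"
      \<comment> \<open>The closed formula is available for positive gains only, hence on an open set around \<open>r\<close>.\<close>
    proof (rule has_field_derivative_transform_within_open[of _ _ _ "{0<..}"])
      fix s :: real assume "s \<in> {0<..}"
      then have c: "quadratic_gamma_channel M X G N \<alpha> l l s" using channel[OF X assms(3)] by simp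
      then show "\<alpha> * ln (1 + s) - 2 * s * \<alpha> + gamma_mean_ln_hyp01 \<alpha> s =
          mutual_info M X (quadratic_gamma_output l G N X s)"
        using quadratic_gamma_channel.mutual_info_formula(2)[OF c] quadratic_gamma_channel.s_def[OF c] assms(3)
        by simp
    qed (use r in auto)
    then show ?thesis using D(2) by (intro exI[of _ "\<alpha> / (1 + r) - 2 * \<alpha> + D"]) auto
  qed
  have "mutual_info_finite M X (quadratic_gamma_output l G N X r) \<and>
      mutual_info M X (quadratic_gamma_output l G N X r) \<le> \<alpha> * ln (1 + r)"
    if "distr M borel X = gamma_law \<alpha> l" "r > 0" for r
    using general[OF that(1) assms(3) that(2)] assms(3) by simp
  then show ?thesis using general deriv by blast
qed

end
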